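(* Let $\Sigma_{\mathcal G}$ be the smallest $\sigma$-algebra on $\mathcal G$ containing the sets $O(E)$ for all uniform properties $E$. Then there exists a probability measure $P_{\mathcal G}$ on $\Sigma_{\mathcal G}$ such that for every uniform property $E$, $$P_{\mathcal G}(O(E)) = \prod_{p\in\mathbb P} P_p\big(E^{-1}(\{1\})\big),$$ where $E^{-1}(\{1\})\subseteq\mathcal G_P$ is transported to $\mathcal G_p$ via the canonical bijection. In particular every set $O(E)$, $E$ a uniform property, is measurable.
   Context: All groups are finite abelian and considered up to isomorphism. $\mathbb P$ is the set of primes. $\mathcal G$ is the set of isomorphism classes of finite abelian groups, and $\mathcal G_p$ the set of isomorphism classes of finite abelian $p$-groups. $\mathcal G_P$ is the set of integer partitions; for each prime $p$ there is a canonical bijection $\mathcal G_P\to\mathcal G_p$ sending a partition with distinct parts $e_1>\dots>e_k$ occurring with multiplicities $r_1,\dots,r_k$ to $\prod_i(\mathbb Z/p^{e_i})^{r_i}$. For $G\in\mathcal G$, $G_p$ denotes its $p$-primary part, identified with a partition. The local Cohen–Lenstra probability $P_p$ is the probability measure on the power set of $\mathcal G_p$ (equivalently of $\mathcal G_P$) with $P_p(\{H\})=\frac{1}{\#\mathrm{Aut}(H)}\prod_{i\ge1}(1-p^{-i})$. A uniform property is a function $E:\mathcal G_P\to\{0,1\}$, extended to $\mathcal G$ by $E(G)=1$ iff $E(G_p)=1$ for all primes $p$; set $O(E)=\{G\in\mathcal G: E(G)=1\}$. The infinite product of numbers in $[0,1]$ is understood as the limit of partial products (which lies in $[0,1]$).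 *)

theory Defs
  imports
    "HOL-Probability.Probability_Measure"
    "HOL-Computational_Algebra.Primes"
    "HOL-Library.Multiset"
    "HOL-Algebra.Bij"
    "HOL-Algebra.Elementary_Groups"
    "HOL-Algebra.Product_Groups"
begin

text \<open>
  Isomorphism classes are taken among the groups whose carrier is a set of natural numbers; every
  finite group is isomorphic to one of these, so no class of finite abelian groups is lost.
\<close>

definition fin_ab_groups :: "nat monoid set" where
  "fin_ab_groups = {G. comm_group G \<and> finite (carrier G)}"

definition iso_class :: "('a, 'b) monoid_scheme \<Rightarrow> nat monoid set" where
  "iso_class G = {H \<in> fin_ab_groups. G \<cong> H}"

definition fin_ab_classes :: "nat monoid set set" where
  "fin_ab_classes = iso_class ` fin_ab_groups"

definition p_classes :: "nat \<Rightarrow> nat monoid set set" where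
  "p_classes p = iso_class ` {G \<in> fin_ab_groups. \<exists>k. order G = p ^ k}"

definition rep :: "nat monoid set \<Rightarrow> nat monoid" where
  "rep X = (SOME G. G \<in> X)"

definition primary_part :: "nat \<Rightarrow> ('a, 'b) monoid_scheme \<Rightarrow> ('a, 'b) monoid_scheme" where
  "primary_part p G =
     G\<lparr>carrier := {x \<in> carrier G. \<exists>k::nat. x [^]\<^bsub>G\<^esub> (p ^ k) = \<one>\<^bsub>G\<^esub>}\<rparr>"

definition primary_class :: "nat \<Rightarrow> nat monoid set \<Rightarrow> nat monoid set" where
  "primary_class p X = iso_class (primary_part p (rep X))"

text \<open>An integer partition is the multiset of its (positive) parts.\<close>

definition partitions :: "nat multiset set" where
  "partitions = {l. 0 \<notin># l}"

text \<open>
  The index \<open>(e, j)\<close> runs over the distinct parts \<open>e\<close> and over \<open>j < count l e\<close>, so that the factor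
  \<open>\<int>/p\<^sup>e\<close> occurs as often as \<open>e\<close> occurs in \<open>l\<close>.
\<close>

definition partition_class :: "nat \<Rightarrow> nat multiset \<Rightarrow> nat monoid set" where
  "partition_class p l =
     iso_class (product_group (SIGMA e:set_mset l. {..<count l e})
       (\<lambda>(e, j). integer_mod_group (p ^ e)))"

definition class_partition :: "nat \<Rightarrow> nat monoid set \<Rightarrow> nat multiset" where
  "class_partition p = inv_into partitions (partition_class p)"

definition cohen_lenstra :: "nat \<Rightarrow> nat monoid set measure" where
  "cohen_lenstra p = point_measure (p_classes p)
     (\<lambda>X. ennreal (1 / real (order (AutoGroup (rep X))) * (\<Prod>i. 1 - 1 / real p ^ Suc i)))"

text \<open>
  A uniform property is a Boolean-valued function on partitions. It is given as a total predicate
  on multisets, of which only the values on \<^const>\<open>partitions\<close> are ever used.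
\<close>

definition uniform_holds :: "(nat multiset \<Rightarrow> bool) \<Rightarrow> nat monoid set \<Rightarrow> bool" where
  "uniform_holds E X \<longleftrightarrow> (\<forall>p. prime p \<longrightarrow> E (class_partition p (primary_class p X)))"

definition uniform_set :: "(nat multiset \<Rightarrow> bool) \<Rightarrow> nat monoid set set" where
  "uniform_set E = {X \<in> fin_ab_classes. uniform_holds E X}"

end

theory Submission
  imports Defs "HOL-Algebra.Weak_Morphisms" "HOL-Algebra.Multiplicative_Group"
    "HOL-Number_Theory.Cong"
    "HOL-Probability.Infinite_Product_Measure" "HOL-Probability.Probability_Mass_Function"
begin

text \<open>
  A uniform property only sees the set of partitions that occur among the primary parts of a group,
  and every finite set of partitions containing the empty one occurs. Under the product of the local
  Cohen--Lenstra measures a random sequence of partitions almost surely has finitely many values,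
  the empty partition among them: at \<open>p\<close> the probability of a partition other than
  \<open>{#}\<close> and \<open>{#1#}\<close> is \<open>O(p\<^sup>-\<^sup>2)\<close>, so Borel--Cantelli applies, although almost no sequence is the
  sequence of primary parts of a finite group. Sending a sequence to some group with the same set of
  values pushes the product measure forward to the required measure.

  That the local weights sum to \<open>1\<close> is Hall's identity. An automorphism of the \<open>p\<close>-group of type \<open>l\<close> is
  given by the images of a basis, and counting these yields
  \<open>p ^ (\<Sum>x\<in>#l. \<Sum>y\<in>#l. min x y) * (\<Prod>d\<in>set_mset l. \<Prod>k=1..count l d. 1 - t ^ k)\<close> with \<open>t = 1 / p\<close>.
  Removing the first column of the Young diagram gives a recursion for the sum of the reciprocals
  over the partitions with \<open>n\<close> parts; by the Durfee square identity its solution is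
  \<open>t ^ n\<^sup>2 / (\<Prod>k=1..n. 1 - t ^ k)\<^sup>2\<close>.
\<close>

section \<open>Gaussian binomials and Durfee squares\<close>

text \<open>The type \<open>{#1#}\<close> has mass of order \<open>1/p\<close> at \<open>p\<close>,
  and the sum of \<open>1/p\<close> over the primes diverges; by independence almost every sequence
  has infinitely many nontrivial entries. Only the types other than \<open>{#}\<close> and
  \<open>{#1#}\<close> are summably rare, which is why finiteness is sought for the set of values
  and not for the support. Replacing a sequence by a group with the same values loses nothing,
  because the generating sets \<open>uniform_set E\<close> do not separate classes with equal sets
  of types. An infinite product of measures requires local masses equal to exactly 1, so Hall's
  identity has to be proved as an equality. The recursion behind it determines its solution: the
  equation for \<open>n\<close> contains the \<open>n\<close>-th unknown on both sides, on the right
  with coefficient \<open>t^(n^2)\<close>, which is less than 1 for \<open>n > 0\<close>. Summing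
  the solution over \<open>n\<close> is the limit of the same Durfee identity that solves the
  recursion.\<close>

definition qpoch :: "real \<Rightarrow> nat \<Rightarrow> real" where
  "qpoch t n = (\<Prod>k<n. 1 - t ^ Suc k)"

lemma qpoch_0 [simp]: "qpoch t 0 = 1"
  by (simp add: qpoch_def)

lemma qpoch_Suc: "qpoch t (Suc n) = qpoch t n * (1 - t ^ Suc n)"
  by (simp add: qpoch_def)

text \<open>A q-Pascal rule instead of a quotient of the q-Pochhammer symbols
  \<open>qpoch t n\<close>, classically \<open>(t; t)_n\<close>: the Durfee sum is evaluated by
  induction along this rule, and entries with \<open>n < m\<close> vanish.
  \<open>qbinom_qpoch\<close> recovers the quotient.\<close>

fun qbinom :: "real \<Rightarrow> nat \<Rightarrow> nat \<Rightarrow> real" where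
  "qbinom t n 0 = 1"
| "qbinom t 0 (Suc m) = 0"
| "qbinom t (Suc n) (Suc m) = t ^ Suc m * qbinom t n (Suc m) + qbinom t n m"

lemma qbinom_eq_0: "n < m \<Longrightarrow> qbinom t n m = 0"
  by (induction t n m rule: qbinom.induct) auto

lemma qbinom_self: "qbinom t n n = 1"
  by (induction n) (auto simp: qbinom_eq_0)

lemma qpoch_pos:
  assumes "0 < t" "t < 1"
  shows "qpoch t n > 0"
  unfolding qpoch_def using assms by (intro prod_pos) (auto simp: power_Suc_less_one simp del: power_Suc)

lemma qbinom_qpoch: "m \<le> n \<Longrightarrow> qbinom t n m * (qpoch t m * qpoch t (n - m)) = qpoch t n"
proof (induction t n m rule: qbinom.induct)
  case (3 t n m)
  show ?case
  proof (cases "m = n")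
    case True
    then show ?thesis by (simp add: qbinom_self del: qbinom.simps)
  next
    case False
    then have mn: "Suc m \<le> n" using 3 by simp
    then obtain d where d: "n = Suc m + d" using le_Suc_ex by blast
    have "qbinom t (Suc n) (Suc m) * (qpoch t (Suc m) * qpoch t (n - m)) =
      t ^ Suc m * (1 - t ^ (n - m)) * (qbinom t n (Suc m) * (qpoch t (Suc m) * qpoch t (n - Suc m))) +
      (1 - t ^ Suc m) * (qbinom t n m * (qpoch t m * qpoch t (n - m)))"
      using d by (simp add: qpoch_Suc algebra_simps)
    also have "\<dots> = (t ^ Suc m * (1 - t ^ (n - m)) + (1 - t ^ Suc m)) * qpoch t n"
      using 3 mn by (simp add: algebra_simps)
    also have "t ^ Suc m * (1 - t ^ (n - m)) + (1 - t ^ Suc m) = 1 - t ^ Suc n"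
      using d by (simp add: algebra_simps power_add)
    finally show ?thesis by (simp add: qpoch_Suc mult.commute)
  qed
qed auto

text \<open>
  Durfee rectangles: with \<open>S n a\<close> for the left-hand side, the recursion of the Gaussian binomial
  gives \<open>S (n + 1) a = S n (a + 1)\<close>.
\<close>

lemma durfee_rectangle:
  assumes t: "0 < t" "t < 1"
  shows "(\<Sum>m\<le>n. t ^ (m * (m + a)) * qbinom t n m / qpoch t (m + a)) = 1 / qpoch t (n + a)"
proof (induction n arbitrary: a)
  case (Suc n)
  have pos: "qpoch t k \<noteq> 0" for k using qpoch_pos[OF t, of k] by simp
  define f where "f n a m = t ^ (m * (m + a)) * qbinom t n m / qpoch t (m + a)" for n a m
  define g where "g m = t ^ (m * (m + a)) * (t ^ m * qbinom t n m) / qpoch t (m + a)" for m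
  define h where "h m = t ^ (Suc m * (Suc m + a)) * qbinom t n m / qpoch t (Suc m + a)" for m
  have "(\<Sum>m\<le>Suc n. f (Suc n) a m) = f (Suc n) a 0 + (\<Sum>m\<le>n. f (Suc n) a (Suc m))"
    by (rule sum.atMost_Suc_shift)
  also have "(\<Sum>m\<le>n. f (Suc n) a (Suc m)) = (\<Sum>m\<le>n. g (Suc m) + h m)"
    by (simp add: f_def g_def h_def add_divide_distrib algebra_simps)
  also have "f (Suc n) a 0 = g 0" by (simp add: f_def g_def)
  also have "g 0 + (\<Sum>m\<le>n. g (Suc m) + h m) = (\<Sum>m\<le>Suc n. g m) + (\<Sum>m\<le>n. h m)"
    unfolding sum.atMost_Suc_shift sum.distrib by simp
  also have "(\<Sum>m\<le>Suc n. g m) = (\<Sum>m\<le>n. g m)" by (simp add: g_def qbinom_eq_0)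
  also have "\<dots> + (\<Sum>m\<le>n. h m) = (\<Sum>m\<le>n. g m + h m)" by (simp add: sum.distrib)
  also have "\<dots> = (\<Sum>m\<le>n. f n (Suc a) m)"
  proof (rule sum.cong)
    fix m
    \<comment> \<open>\<open>q\<close> is the numerator of \<open>f n (Suc a) m\<close>. Over the
      denominator \<open>qpoch t (Suc (m + a))\<close> the terms \<open>g m\<close> and
      \<open>h m\<close> carry the complementary factors \<open>1 - x\<close> and \<open>x\<close>
      with \<open>x = t ^ Suc (m + a)\<close>.\<close>
    define q where "q = t ^ (m * (m + Suc a)) * qbinom t n m"
    have "g m = q / qpoch t (m + a)"
      by (simp add: g_def q_def power_add algebra_simps)
    also have "\<dots> = q * (1 - t ^ Suc (m + a)) / qpoch t (Suc (m + a))"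
      using pos[of "Suc (m + a)"] by (simp add: qpoch_Suc del: power_Suc)
    finally have g: "g m = q * (1 - t ^ Suc (m + a)) / qpoch t (Suc (m + a))" .
    have h: "h m = q * t ^ Suc (m + a) / qpoch t (Suc (m + a))"
      by (simp add: h_def q_def power_add algebra_simps)
    show "g m + h m = f n (Suc a) m"
      unfolding g h by (simp add: f_def q_def add_divide_distrib[symmetric] algebra_simps)
  qed simp
  also have "\<dots> = 1 / qpoch t (n + Suc a)" unfolding f_def by (rule Suc.IH)
  finally show ?case by (simp add: f_def)
qed auto

text \<open>The case \<open>a = 0\<close> of the rectangle identity, divided by
  \<open>qpoch t n\<close>. In this form it says that
  \<open>t ^ n\<^sup>2 / (qpoch t n)\<^sup>2\<close> solves the fixed point equation attached to
  \<open>bounded_weight_Suc\<close>.\<close>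

lemma durfee_square:
  assumes t: "0 < t" "t < 1"
  shows "(\<Sum>m\<le>n. t ^ m\<^sup>2 / (qpoch t m)\<^sup>2 / qpoch t (n - m)) = 1 / (qpoch t n)\<^sup>2"
proof -
  have pos: "qpoch t k > 0" for k by (rule qpoch_pos[OF t])
  have "t ^ m\<^sup>2 / (qpoch t m)\<^sup>2 / qpoch t (n - m) = t ^ (m * (m + 0)) * qbinom t n m / qpoch t (m + 0) / qpoch t n"
    if "m \<le> n" for m
    unfolding qbinom_qpoch[OF that, of t, symmetric] 
    using pos[of m] pos[of "n - m"] qbinom_qpoch[OF that, of t] pos[of n]
    by (auto simp: field_simps power2_eq_square)
  then have "(\<Sum>m\<le>n. t ^ m\<^sup>2 / (qpoch t m)\<^sup>2 / qpoch t (n - m)) =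
      (\<Sum>m\<le>n. t ^ (m * (m + 0)) * qbinom t n m / qpoch t (m + 0)) / qpoch t n"
    unfolding sum_divide_distrib by (intro sum.cong) auto
  then show ?thesis
    unfolding durfee_rectangle[OF t] by (simp add: power2_eq_square)
qed

section \<open>Hall's identity\<close>

text \<open>The double sum of minima is the sum of the squared column lengths of the Young diagram,
  so a column of length \<open>n\<close> accounts for a factor \<open>t ^ n\<^sup>2\<close>. For
  \<open>t = 1 / p\<close> this is the reciprocal of the number of automorphisms.\<close>

definition part_weight :: "real \<Rightarrow> nat multiset \<Rightarrow> real" where
  "part_weight t l = t ^ (\<Sum>x\<in>#l. \<Sum>y\<in>#l. min x y) / (\<Prod>d\<in>set_mset l. qpoch t (count l d))"

lemma part_weight_pos:
  assumes "0 < t" "t < 1"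
  shows "part_weight t l > 0"
  unfolding part_weight_def using assms qpoch_pos[OF assms] by (intro divide_pos_pos prod_pos) auto

text \<open>The bound \<open>K\<close> on the number of columns keeps all sums finite and turns the
  removal of a column into an induction on \<open>K\<close>; it is released by a limit
  later.\<close>

definition bounded_partitions :: "nat \<Rightarrow> nat \<Rightarrow> nat multiset set" where
  "bounded_partitions K n = {l \<in> partitions. size l = n \<and> (\<forall>x\<in>#l. x \<le> K)}"

lemma finite_bounded_partitions: "finite (bounded_partitions K n)"
proof (rule finite_subset)
  show "bounded_partitions K n \<subseteq> mset ` {xs. set xs \<subseteq> {..K} \<and> length xs = n}"
  proof
    fix l assume "l \<in> bounded_partitions K n"
    moreover obtain xs where "l = mset xs" using ex_mset by metis
    ultimately show "l \<in> mset ` {xs. set xs \<subseteq> {..K} \<and> length xs = n}"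
      by (auto simp: bounded_partitions_def)
  qed
  show "finite (mset ` {xs. set xs \<subseteq> {..K} \<and> length xs = n})"
    by (intro finite_imageI finite_lists_length_eq) auto
qed

text \<open>Adds a first column of height \<open>n\<close> to the Young diagram whose rows are the parts.\<close>

definition add_column :: "nat \<Rightarrow> nat multiset \<Rightarrow> nat multiset" where
  "add_column n l = image_mset Suc (l + replicate_mset (n - size l) 0)"

text \<open>Padding with zeros changes no minimum; raising all \<open>n\<close> entries by one then
  adds 1 to each of the \<open>n\<^sup>2\<close> minima. The padded zeros become
  \<open>n - size l\<close> parts equal to 1, the only new multiplicity, and the old multiplicities
  merely move up.\<close>

lemma part_weight_add_column:
  assumes l: "l \<in> partitions" "size l \<le> n"
  shows "part_weight t (add_column n l) = t ^ n\<^sup>2 * (part_weight t l / qpoch t (n - size l))"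
proof -
  define L where "L = l + replicate_mset (n - size l) 0"
  have sz: "size L = n" using l by (simp add: L_def)
  have c: "count (image_mset Suc L) (Suc d) = count L d" for d
    by (induction L) auto
  have L0: "count L 0 = n - size l" and LS: "d \<noteq> 0 \<Longrightarrow> count L d = count l d" for d
    using l by (auto simp: L_def partitions_def not_in_iff)
  have "(\<Sum>x\<in>#image_mset Suc L. \<Sum>y\<in>#image_mset Suc L. min x y) = (\<Sum>x\<in>#L. \<Sum>y\<in>#L. min x y + 1)"
    by (simp add: multiset.map_comp o_def)
  also have "\<dots> = n\<^sup>2 + (\<Sum>x\<in>#L. \<Sum>y\<in>#L. min x y)"
    by (simp only: sum_mset.distrib sum_mset_constant) (simp add: sz power2_eq_square)
  also have "(\<Sum>x\<in>#L. \<Sum>y\<in>#L. min x y) = (\<Sum>x\<in>#l. \<Sum>y\<in>#l. min x y)"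
    by (simp add: L_def)
  finally have e: "(\<Sum>x\<in>#image_mset Suc L. \<Sum>y\<in>#image_mset Suc L. min x y) = n\<^sup>2 + (\<Sum>x\<in>#l. \<Sum>y\<in>#l. min x y)" .
  have "(\<Prod>d\<in>set_mset (image_mset Suc L). qpoch t (count (image_mset Suc L) d)) = (\<Prod>d\<in>set_mset L. qpoch t (count L d))"
    using c by (simp add: prod.reindex)
  also have "\<dots> = (\<Prod>d\<in>insert 0 (set_mset l). qpoch t (count L d))"
    by (rule prod.mono_neutral_left) (auto simp: L_def not_in_iff)
  also have "\<dots> = qpoch t (n - size l) * (\<Prod>d\<in>set_mset l. qpoch t (count l d))"
  proof -
    have "(\<Prod>d\<in>set_mset l. qpoch t (count L d)) = (\<Prod>d\<in>set_mset l. qpoch t (count l d))"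
      using l by (intro prod.cong refl arg_cong[where f = "qpoch t"] LS) (auto simp: partitions_def intro!: gr0I)
    then show ?thesis using l L0 by (subst prod.insert) (auto simp: partitions_def)
  qed
  finally show ?thesis
    unfolding part_weight_def add_column_def L_def[symmetric] e by (simp add: power_add)
qed

text \<open>The inverse deletes the first column: every part drops by one and parts that become zero
  disappear. Their number is recovered from the prescribed height \<open>n\<close>.\<close>

lemma bij_betw_add_column:
  "bij_betw (add_column n) (\<Union>m\<le>n. bounded_partitions K m) (bounded_partitions (Suc K) n)"
proof (rule bij_betw_byWitness[where f' = "\<lambda>l. filter_mset (\<lambda>x. x \<noteq> 0) (image_mset (\<lambda>x. x - 1) l)"])
  show "\<forall>l\<in>\<Union>m\<le>n. bounded_partitions K m. filter_mset (\<lambda>x. x \<noteq> 0) (image_mset (\<lambda>x. x - 1) (add_column n l)) = l"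
  proof
    fix l assume "l \<in> (\<Union>m\<le>n. bounded_partitions K m)"
    then have "filter_mset (\<lambda>x. x \<noteq> 0) l = l"
      by (intro filter_mset_eq_conv[THEN iffD2]) (auto simp: bounded_partitions_def partitions_def intro!: gr0I)
    then show "filter_mset (\<lambda>x. x \<noteq> 0) (image_mset (\<lambda>x. x - 1) (add_column n l)) = l"
      by (simp add: add_column_def multiset.map_comp o_def)
  qed
next
  show "\<forall>l\<in>bounded_partitions (Suc K) n. add_column n (filter_mset (\<lambda>x. x \<noteq> 0) (image_mset (\<lambda>x. x - 1) l)) = l"
  proof
    fix l assume l: "l \<in> bounded_partitions (Suc K) n"
    define L where "L = image_mset (\<lambda>x. x - 1) l"
    have L: "L = filter_mset (\<lambda>x. x \<noteq> 0) L + filter_mset (\<lambda>x. x = 0) L"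
      by (metis (no_types, lifting) add.commute filter_mset_cong multiset_partition)
    moreover have "filter_mset (\<lambda>x. x = 0) L = replicate_mset (n - size (filter_mset (\<lambda>x. x \<noteq> 0) L)) 0"
    proof -
      have "size L = n" using l by (simp add: L_def bounded_partitions_def)
      then have "n - size (filter_mset (\<lambda>x. x \<noteq> 0) L) = count L 0"
        using L by (metis add_diff_cancel_left' filter_eq_replicate_mset size_replicate_mset size_union)
      then show ?thesis by (simp add: filter_eq_replicate_mset)
    qed
    ultimately have "add_column n (filter_mset (\<lambda>x. x \<noteq> 0) L) = image_mset Suc L"
      by (simp add: add_column_def)
    also have "\<dots> = image_mset (\<lambda>x. x) l"
      unfolding L_def multiset.map_comp using l
      by (intro image_mset_cong) (auto simp: bounded_partitions_def partitions_def o_def intro!: Suc_pred gr0I)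
    finally show "add_column n (filter_mset (\<lambda>x. x \<noteq> 0) (image_mset (\<lambda>x. x - 1) l)) = l"
      by (simp add: L_def)
  qed
next
  show "add_column n ` (\<Union>m\<le>n. bounded_partitions K m) \<subseteq> bounded_partitions (Suc K) n"
    by (auto simp: bounded_partitions_def partitions_def add_column_def split: if_splits)
next
  show "(\<lambda>l. filter_mset (\<lambda>x. x \<noteq> 0) (image_mset (\<lambda>x. x - 1) l)) ` bounded_partitions (Suc K) n
    \<subseteq> (\<Union>m\<le>n. bounded_partitions K m)"
  proof safe
    fix l assume l: "l \<in> bounded_partitions (Suc K) n"
    have "size (filter_mset (\<lambda>x. x \<noteq> 0) (image_mset (\<lambda>x. x - 1) l)) \<le> size (image_mset (\<lambda>x. x - 1) l)"
      by (rule size_filter_mset_lesseq)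
    then show "filter_mset (\<lambda>x. x \<noteq> 0) (image_mset (\<lambda>x. x - 1) l) \<in> (\<Union>m\<le>n. bounded_partitions K m)"
      using l by (force simp: bounded_partitions_def partitions_def)
  qed
qed

definition bounded_weight :: "real \<Rightarrow> nat \<Rightarrow> nat \<Rightarrow> real" where
  "bounded_weight t K n = (\<Sum>l\<in>bounded_partitions K n. part_weight t l)"

lemma bounded_weight_Suc:
  "bounded_weight t (Suc K) n = t ^ n\<^sup>2 * (\<Sum>m\<le>n. bounded_weight t K m / qpoch t (n - m))"
proof -
  have "bounded_weight t (Suc K) n = (\<Sum>l\<in>(\<Union>m\<le>n. bounded_partitions K m). part_weight t (add_column n l))"
    unfolding bounded_weight_def by (rule sum.reindex_bij_betw[OF bij_betw_add_column, symmetric])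
  also have "\<dots> = (\<Sum>m\<le>n. \<Sum>l\<in>bounded_partitions K m. part_weight t (add_column n l))"
    using finite_bounded_partitions by (intro sum.UNION_disjoint) (auto simp: bounded_partitions_def)
  also have "\<dots> = (\<Sum>m\<le>n. \<Sum>l\<in>bounded_partitions K m. t ^ n\<^sup>2 * (part_weight t l / qpoch t (n - m)))"
    using part_weight_add_column by (intro sum.cong refl) (auto simp: bounded_partitions_def)
  also have "\<dots> = t ^ n\<^sup>2 * (\<Sum>m\<le>n. bounded_weight t K m / qpoch t (n - m))"
    by (simp add: bounded_weight_def sum_distrib_left sum_divide_distrib)
  finally show ?thesis .
qed

lemma bounded_weight_0: "bounded_weight t 0 n = (if n = 0 then 1 else 0)"
proof -
  have "bounded_partitions 0 n = (if n = 0 then {{#}} else {})"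
    by (auto simp: bounded_partitions_def partitions_def) (metis multiset_nonemptyE size_empty less_irrefl)
  then show ?thesis by (simp add: bounded_weight_def part_weight_def)
qed

lemma bounded_weight_mono:
  assumes "0 < t" "t < 1" "K \<le> K'"
  shows "bounded_weight t K n \<le> bounded_weight t K' n"
  unfolding bounded_weight_def using assms part_weight_pos[OF assms(1,2), THEN less_imp_le]
  by (intro sum_mono2 finite_bounded_partitions) (auto simp: bounded_partitions_def)

text \<open>By \<open>durfee_square\<close> the claimed limit \<open>g\<close> is a fixed point of
  the monotone recursion in \<open>K\<close>, hence an upper bound for all its iterates. The
  iterates increase, so they converge to some fixed point \<open>f\<close>, and \<open>f = g\<close>
  follows by strong induction on \<open>n\<close>.\<close>

lemma bounded_weight_tendsto:
  assumes t: "0 < t" "t < 1"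
  shows "(\<lambda>K. bounded_weight t K n) \<longlonglongrightarrow> t ^ n\<^sup>2 / (qpoch t n)\<^sup>2"
proof -
  define g where "g n = t ^ n\<^sup>2 / (qpoch t n)\<^sup>2" for n
  have q: "qpoch t n > 0" for n by (rule qpoch_pos[OF t])
  have fix_g: "t ^ n\<^sup>2 * (\<Sum>m\<le>n. g m / qpoch t (n - m)) = g n" for n
    unfolding g_def durfee_square[OF t] by simp
  have le: "bounded_weight t K n \<le> g n" for K n
  proof (induction K arbitrary: n)
    case 0
    show ?case using t q by (simp add: bounded_weight_0 g_def)
  next
    case (Suc K)
    have "bounded_weight t (Suc K) n \<le> t ^ n\<^sup>2 * (\<Sum>m\<le>n. g m / qpoch t (n - m))"
      unfolding bounded_weight_Suc using Suc q t
      by (intro mult_left_mono sum_mono divide_right_mono) (auto intro: less_imp_le)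
    then show ?case by (simp add: fix_g)
  qed
  define f where "f n = (SUP K. bounded_weight t K n)" for n
  have lim: "(\<lambda>K. bounded_weight t K n) \<longlonglongrightarrow> f n" for n
    unfolding f_def using le
    by (intro LIMSEQ_incseq_SUP) (auto simp: incseq_def bounded_weight_mono[OF t] bdd_above_def)
  have fix_f: "t ^ n\<^sup>2 * (\<Sum>m\<le>n. f m / qpoch t (n - m)) = f n" for n
  proof -
    have "(\<lambda>K. t ^ n\<^sup>2 * (\<Sum>m\<le>n. bounded_weight t K m / qpoch t (n - m))) \<longlonglongrightarrow> t ^ n\<^sup>2 * (\<Sum>m\<le>n. f m / qpoch t (n - m))"
      using q by (intro tendsto_intros lim) (auto simp: less_imp_neq[symmetric])
    then have "(\<lambda>K. bounded_weight t (Suc K) n) \<longlonglongrightarrow> t ^ n\<^sup>2 * (\<Sum>m\<le>n. f m / qpoch t (n - m))"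
      by (simp add: bounded_weight_Suc)
    moreover have "(\<lambda>K. bounded_weight t (Suc K) n) \<longlonglongrightarrow> f n"
      using lim LIMSEQ_Suc by blast
    ultimately show ?thesis by (rule LIMSEQ_unique)
  qed
  have "f n = g n" for n
  proof (induction n rule: less_induct)
    case (less n)
    show ?case
    \<comment> \<open>At \<open>n = 0\<close> the fixed point equation is void because its
      coefficient is 1, so the value is computed directly; for \<open>n > 0\<close> one divides by
      \<open>1 - t ^ n\<^sup>2\<close>.\<close>
    proof (cases "n = 0")
      case True
      have "bounded_weight t K 0 = 1" for K
      proof -
        have "bounded_partitions K 0 = {{#}}" by (auto simp: bounded_partitions_def partitions_def)
        then show ?thesis by (simp add: bounded_weight_def part_weight_def)
      qed
      then show ?thesis using True by (simp add: f_def g_def)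
    next
      case False
      have split: "(\<Sum>m\<le>n. h m / qpoch t (n - m)) = (\<Sum>m<n. h m / qpoch t (n - m)) + h n" for h :: "nat \<Rightarrow> real"
        by (simp add: lessThan_Suc_atMost[symmetric])
      have "(1 - t ^ n\<^sup>2) * f n = t ^ n\<^sup>2 * (\<Sum>m<n. f m / qpoch t (n - m))"
        using fix_f[of n] by (simp add: split algebra_simps)
      also have "\<dots> = t ^ n\<^sup>2 * (\<Sum>m<n. g m / qpoch t (n - m))"
        using less by simp
      also have "\<dots> = (1 - t ^ n\<^sup>2) * g n"
        using fix_g[of n] by (simp add: split algebra_simps)
      finally show ?thesis
        using False t power_less_one_iff[of t "n\<^sup>2"] by auto
    qed
  qed
  then show ?thesis using lim[of n] by (simp add: g_def)
qed

section \<open>Infinite q-products and the sum over the number of parts\<close>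

lemma qpoch_tendsto:
  assumes t: "0 < t" "t < 1"
  shows "qpoch t \<longlonglongrightarrow> (\<Prod>i. 1 - t ^ Suc i)" "(\<Prod>i. 1 - t ^ Suc i) > 0"
proof -
  have pos: "1 - t ^ Suc i > 0" for i using t by (simp add: power_Suc_less_one del: power_Suc)
  have "summable (\<lambda>i. t ^ Suc i)" using t by (subst summable_Suc_iff) simp
  then have "summable (\<lambda>i. norm ((1 - t ^ Suc i) - 1))" using t by simp
  then have conv: "convergent_prod (\<lambda>i. 1 - t ^ Suc i)"
    by (intro abs_convergent_prod_imp_convergent_prod) (simp only: abs_convergent_prod_conv_summable)
  have "(\<lambda>n. qpoch t (Suc n)) \<longlonglongrightarrow> (\<Prod>i. 1 - t ^ Suc i)"
    unfolding qpoch_def lessThan_Suc_atMost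
    by (rule convergent_prod_LIMSEQ) fact
  then show "qpoch t \<longlonglongrightarrow> (\<Prod>i. 1 - t ^ Suc i)" by (rule LIMSEQ_imp_Suc)
  show "(\<Prod>i. 1 - t ^ Suc i) > 0"
    using \<open>convergent_prod _\<close> pos by (intro less_0_prodinf)
qed

text \<open>The limit of \<open>durfee_square\<close> after multiplication by
  \<open>qpoch t n\<close>. The extra ratios \<open>qpoch t n / qpoch t (n - m)\<close> are at most
  1, which bounds the partial sums from below; for a fixed cutoff \<open>M\<close> they tend to 1,
  which bounds them from above.\<close>

lemma durfee_sums:
  assumes t: "0 < t" "t < 1"
  shows "(\<lambda>n. t ^ n\<^sup>2 / (qpoch t n)\<^sup>2) sums (1 / (\<Prod>i. 1 - t ^ Suc i))"
proof -
  define \<eta> where "\<eta> = (\<Prod>i. 1 - t ^ Suc i)"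
  have \<eta>: "qpoch t \<longlonglongrightarrow> \<eta>" "\<eta> > 0" using qpoch_tendsto[OF t] by (auto simp: \<eta>_def)
  define g where "g n = t ^ n\<^sup>2 / (qpoch t n)\<^sup>2" for n
  have q: "qpoch t n > 0" for n by (rule qpoch_pos[OF t])
  have g0: "g n \<ge> 0" for n using t q by (simp add: g_def)
  have dec: "decseq (qpoch t)"
    using q t by (intro decseq_SucI) (simp add: qpoch_Suc mult_left_le del: power_Suc)
  define s where "s n M = (\<Sum>m\<le>M. g m * (qpoch t n / qpoch t (n - m)))" for n M
  have s: "s n n = 1 / qpoch t n" for n
  proof -
    have "s n n = qpoch t n * (\<Sum>m\<le>n. t ^ m\<^sup>2 / (qpoch t m)\<^sup>2 / qpoch t (n - m))"
      by (simp add: s_def g_def sum_distrib_left mult_ac)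
    also have "\<dots> = 1 / qpoch t n" unfolding durfee_square[OF t] using q[of n] by (simp add: power2_eq_square)
    finally show ?thesis .
  qed
  have lower: "1 / qpoch t n \<le> (\<Sum>m\<le>n. g m)" for n
    unfolding s[symmetric] s_def
  proof (rule sum_mono)
    fix m
    have "qpoch t n \<le> qpoch t (n - m)" using dec by (simp add: decseq_def)
    then show "g m * (qpoch t n / qpoch t (n - m)) \<le> g m"
      using g0 q by (intro mult_left_le) auto
  qed
  have upper: "(\<Sum>m\<le>M. g m) \<le> 1 / \<eta>" for M
  proof (rule LIMSEQ_le)
    have "(\<lambda>n. s (n + M) M) \<longlonglongrightarrow> (\<Sum>m\<le>M. g m * (\<eta> / \<eta>))"
      unfolding s_def
    proof (intro tendsto_intros)
      fix m assume "m \<in> {..M}"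
      then have "n + M - m = n + (M - m)" for n by auto
      then show "(\<lambda>n. qpoch t (n + M - m)) \<longlonglongrightarrow> \<eta>"
        using LIMSEQ_ignore_initial_segment[OF \<eta>(1), of "M - m"] by simp
      show "(\<lambda>n. qpoch t (n + M)) \<longlonglongrightarrow> \<eta>" by (rule LIMSEQ_ignore_initial_segment[OF \<eta>(1)])
      show "\<eta> \<noteq> 0" using \<eta> by simp
    qed
    then show "(\<lambda>n. s (n + M) M) \<longlonglongrightarrow> (\<Sum>m\<le>M. g m)" using \<eta> by simp
    show "(\<lambda>n. 1 / qpoch t (n + M)) \<longlonglongrightarrow> 1 / \<eta>"
      using \<eta> by (intro tendsto_intros LIMSEQ_ignore_initial_segment) auto
    have "s (n + M) M \<le> s (n + M) (n + M)" for n
      unfolding s_def using g0 q by (intro sum_mono2) (auto intro!: mult_nonneg_nonneg simp: less_imp_le)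
    then show "\<exists>N. \<forall>n\<ge>N. s (n + M) M \<le> 1 / qpoch t (n + M)" by (auto simp: s)
  qed
  have "(\<lambda>n. \<Sum>m\<le>n. g m) \<longlonglongrightarrow> 1 / \<eta>"
  proof (rule tendsto_sandwich)
    show "\<forall>\<^sub>F n in sequentially. 1 / qpoch t n \<le> (\<Sum>m\<le>n. g m)" using lower by simp
    show "\<forall>\<^sub>F n in sequentially. (\<Sum>m\<le>n. g m) \<le> 1 / \<eta>" using upper by simp
    show "(\<lambda>n. 1 / qpoch t n) \<longlonglongrightarrow> 1 / \<eta>" using \<eta> by (intro tendsto_intros) auto
  qed simp
  then show ?thesis unfolding g_def \<eta>_def by (simp add: sums_def_le)
qed

lemma nn_integral_part_weight:
  assumes t: "0 < t" "t < 1"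
  shows "(\<integral>\<^sup>+l. ennreal (part_weight t l) * indicator partitions l \<partial>count_space UNIV) =
    ennreal (1 / (\<Prod>i. 1 - t ^ Suc i))"
proof -
  have w: "part_weight t l \<ge> 0" for l using part_weight_pos[OF t] less_imp_le by blast
  define f where "f n l = ennreal (part_weight t l) * indicator {l \<in> partitions. size l = n} l" for n l
  have "(\<Sum>n. f n l) = (\<Sum>n\<in>{size l}. f n l)" for l
    by (rule suminf_finite) (auto simp: f_def)
  then have "ennreal (part_weight t l) * indicator partitions l = (\<Sum>n. f n l)" for l
    by (simp add: f_def indicator_def)
  then have "(\<integral>\<^sup>+l. ennreal (part_weight t l) * indicator partitions l \<partial>count_space UNIV) =
      (\<Sum>n. \<integral>\<^sup>+l. f n l \<partial>count_space UNIV)"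
    by (simp add: nn_integral_suminf)
  also have "\<dots> = (\<Sum>n. ennreal (t ^ n\<^sup>2 / (qpoch t n)\<^sup>2))"
  proof (intro suminf_cong)
    fix n
    show "(\<integral>\<^sup>+l. f n l \<partial>count_space UNIV) = ennreal (t ^ n\<^sup>2 / (qpoch t n)\<^sup>2)"
    proof (rule LIMSEQ_unique)
    define h where "h K l = ennreal (part_weight t l) * indicator (bounded_partitions K n) l" for K l
    have int: "(\<integral>\<^sup>+l. h K l \<partial>count_space UNIV) = ennreal (bounded_weight t K n)" for K
      unfolding h_def bounded_weight_def using finite_bounded_partitions w
      by (subst nn_integral_count_space_indicator[symmetric])
         (auto simp: nn_integral_count_space_finite sum_ennreal)
    have "(\<lambda>K. \<integral>\<^sup>+l. h K l \<partial>count_space UNIV) \<longlonglongrightarrow> (\<integral>\<^sup>+l. f n l \<partial>count_space UNIV)"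
    proof (rule nn_integral_LIMSEQ)
      show "incseq h"
        by (intro incseq_SucI le_funI) (auto simp: h_def bounded_partitions_def split: split_indicator)
      show "(\<lambda>K. h K l) \<longlonglongrightarrow> f n l" for l
      proof (rule tendsto_eventually)
        \<comment> \<open>No part exceeds the sum of all parts, so from there on the bound
          \<open>K\<close> excludes nothing.\<close>
        have "h K l = f n l" if "K \<ge> (\<Sum>x\<in>#l. x)" for K
        proof -
          have "x \<le> K" if "x \<in># l" for x
            using \<open>K \<ge> _\<close> multi_member_split[OF that] by auto
          then show ?thesis by (auto simp: h_def f_def bounded_partitions_def split: split_indicator)
        qed
        then show "\<forall>\<^sub>F K in sequentially. h K l = f n l"
          unfolding eventually_sequentially by blast
      qed
    qed simp
    then show "(\<lambda>K. ennreal (bounded_weight t K n)) \<longlonglongrightarrow> (\<integral>\<^sup>+l. f n l \<partial>count_space UNIV)"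
      unfolding int .
    show "(\<lambda>K. ennreal (bounded_weight t K n)) \<longlonglongrightarrow> ennreal (t ^ n\<^sup>2 / (qpoch t n)\<^sup>2)"
      by (intro tendsto_ennrealI bounded_weight_tendsto t)
  qed
  qed
  also have "\<dots> = ennreal (1 / (\<Prod>i. 1 - t ^ Suc i))"
    using t durfee_sums[OF t] by (intro suminf_ennreal_eq) auto
  finally show ?thesis .
qed

section \<open>Independent families in finite abelian groups\<close>

context comm_group
begin

text \<open>Coefficients are integers and not residues: combinations are then additive in
  \<open>k\<close> for all families, and the orders of the members enter only through the
  divisibility condition in \<open>indep\<close>.\<close>

definition comb :: "'i set \<Rightarrow> ('i \<Rightarrow> 'a) \<Rightarrow> ('i \<Rightarrow> int) \<Rightarrow> 'a" where
  "comb I y k = finprod G (\<lambda>i. y i [^] k i) I"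

lemma comb_closed [simp]: "y \<in> I \<rightarrow> carrier G \<Longrightarrow> comb I y k \<in> carrier G"
  unfolding comb_def by (rule finprod_closed) auto

lemma comb_cong:
  assumes "y' \<in> I \<rightarrow> carrier G" "\<And>i. i \<in> I \<Longrightarrow> y i = y' i" "\<And>i. i \<in> I \<Longrightarrow> k i = k' i"
  shows "comb I y k = comb I y' k'"
  unfolding comb_def using assms by (intro finprod_cong') auto

lemma comb_add:
  assumes "y \<in> I \<rightarrow> carrier G"
  shows "comb I y (\<lambda>i. k i + m i) = comb I y k \<otimes> comb I y m"
proof -
  have "comb I y (\<lambda>i. k i + m i) = finprod G (\<lambda>i. y i [^] k i \<otimes> y i [^] m i) I"
    unfolding comb_def using assms by (intro finprod_cong') (auto simp: int_pow_mult Pi_iff)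
  also have "\<dots> = comb I y k \<otimes> comb I y m"
    unfolding comb_def using assms by (intro finprod_multf) auto
  finally show ?thesis .
qed

lemma comb_zero: "comb I y (\<lambda>_. 0) = \<one>"
  unfolding comb_def by simp

lemma comb_insert:
  assumes "y \<in> insert i I \<rightarrow> carrier G" "finite I" "i \<notin> I"
  shows "comb (insert i I) y k = y i [^] k i \<otimes> comb I y k"
  unfolding comb_def using assms by (intro finprod_insert) auto

lemma comb_minus:
  assumes "y \<in> I \<rightarrow> carrier G"
  shows "comb I y (\<lambda>i. - k i) = inv (comb I y k)"
proof -
  have "comb I y (\<lambda>i. - k i) \<otimes> comb I y k = \<one>"
    using comb_add[OF assms, of "\<lambda>i. - k i" k] by (simp add: comb_zero)
  then show ?thesis
    using assms by (simp add: inv_equality)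
qed

lemma comb_diff:
  assumes "y \<in> I \<rightarrow> carrier G"
  shows "comb I y (\<lambda>i. k i - m i) = comb I y k \<otimes> inv (comb I y m)"
  using comb_add[OF assms, of k "\<lambda>i. - m i"] by (simp add: comb_minus assms)

lemma comb_scale:
  assumes "y \<in> I \<rightarrow> carrier G" "finite I"
  shows "comb I y (\<lambda>i. c * k i) = comb I y k [^] (c :: int)"
  using assms(2,1)
proof (induction I)
  case empty
  then show ?case by (simp add: comb_def)
next
  case (insert i I)
  then have y: "y \<in> I \<rightarrow> carrier G" "y i \<in> carrier G" by auto
  have "comb (insert i I) y (\<lambda>i. c * k i) = y i [^] (c * k i) \<otimes> comb I y k [^] c"
    using insert y by (subst comb_insert) auto
  also have "y i [^] (c * k i) = (y i [^] k i) [^] c"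
    using y by (simp add: int_pow_pow mult.commute)
  also have "\<dots> \<otimes> comb I y k [^] c = comb (insert i I) y k [^] c"
    using insert y by (subst comb_insert) (auto simp: int_pow_distrib)
  finally show ?case .
qed

lemma comb_single:
  assumes "y \<in> I \<rightarrow> carrier G" "finite I" "i \<in> I"
  shows "comb I y (\<lambda>j. if j = i then c else 0) = y i [^] c"
proof -
  have I: "I = insert i (I - {i})" "finite (I - {i})" "i \<notin> I - {i}"
    using assms by auto
  have "comb (I - {i}) y (\<lambda>j. if j = i then c else 0) = comb (I - {i}) y (\<lambda>_. 0)"
    using assms by (intro comb_cong) auto
  then have "comb (insert i (I - {i})) y (\<lambda>j. if j = i then c else 0) = y i [^] c"
    using assms I by (subst comb_insert) (auto simp: comb_zero Pi_iff)
  then show ?thesis using I(1) by metis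
qed

text \<open>Equivalently, the map from the direct sum of the groups \<open>Z / p ^ e i\<close> that
  sends the generators to the \<open>y i\<close> is well defined and injective. A
  \<open>basis\<close> makes it an isomorphism.\<close>

definition indep :: "nat \<Rightarrow> ('i \<Rightarrow> nat) \<Rightarrow> 'i set \<Rightarrow> ('i \<Rightarrow> 'a) \<Rightarrow> bool" where
  "indep p e I y \<longleftrightarrow> y \<in> I \<rightarrow> carrier G \<and>
     (\<forall>k. comb I y k = \<one> \<longleftrightarrow> (\<forall>i\<in>I. int p ^ e i dvd k i))"

definition basis :: "nat \<Rightarrow> ('i \<Rightarrow> nat) \<Rightarrow> 'i set \<Rightarrow> ('i \<Rightarrow> 'a) \<Rightarrow> bool" where
  "basis p e I y \<longleftrightarrow> indep p e I y \<and> (\<forall>x\<in>carrier G. \<exists>k. x = comb I y k)"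

definition torsion :: "int \<Rightarrow> 'a set" where
  "torsion n = {x \<in> carrier G. x [^] n = \<one>}"

lemma indep_comb_eq_iff:
  assumes "indep p e I y"
  shows "comb I y k = comb I y m \<longleftrightarrow> (\<forall>i\<in>I. [k i = m i] (mod int p ^ e i))"
proof -
  have y: "y \<in> I \<rightarrow> carrier G" using assms by (simp add: indep_def)
  have "comb I y k = comb I y m \<longleftrightarrow> comb I y (\<lambda>i. k i - m i) = \<one>"
    unfolding comb_diff[OF y] using y
    by (metis comb_closed inv_closed inv_equality inv_inv r_inv)
  also have "\<dots> \<longleftrightarrow> (\<forall>i\<in>I. int p ^ e i dvd k i - m i)"
    using assms by (simp add: indep_def)
  finally show ?thesis by (simp add: cong_iff_dvd_diff)
qed

lemma indep_cong:
  assumes "indep p e I y" "\<And>i. i \<in> I \<Longrightarrow> y' i = y i"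
  shows "indep p e I y'"
proof -
  have "comb I y' k = comb I y k" for k
    using assms by (intro comb_cong) (auto simp: indep_def)
  with assms show ?thesis by (auto simp: indep_def)
qed

lemma indep_empty: "indep p e {} y"
  by (simp add: indep_def comb_def)

lemma indep_torsion:
  assumes "indep p e I y" "finite I" "i \<in> I"
  shows "y i [^] (int p ^ e i) = \<one>"
proof -
  have "comb I y (\<lambda>j. if j = i then int p ^ e i else 0) = \<one>"
    using assms by (simp add: indep_def)
  then show ?thesis
    using comb_single[of y I i] assms by (simp add: indep_def)
qed

text \<open>Every nontrivial subgroup of a cyclic \<open>p\<close>-group contains its subgroup of
  order \<open>p\<close>. Hence the span of \<open>y i\<close> has full order and meets the span of
  the others trivially as soon as the single element \<open>y i [^] (int p ^ (e i - 1))\<close>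
  avoids the latter.\<close>

lemma indep_insert_iff:
  fixes e :: "'i \<Rightarrow> nat"
  assumes p: "prime p" and I: "finite I" "i \<notin> I" and ei: "e i > 0"
    and y: "y \<in> insert i I \<rightarrow> carrier G"
  shows "indep p e (insert i I) y \<longleftrightarrow> indep p e I y \<and> y i \<in> torsion (int p ^ e i) \<and>
    y i [^] (int p ^ (e i - 1)) \<notin> range (comb I y)" (is "?L \<longleftrightarrow> ?R")
proof
  assume L: ?L
  have ins: "comb (insert i I) y (k(i := c)) = y i [^] c \<otimes> comb I y k" for k c
  proof -
    have "comb I y (k(i := c)) = comb I y k"
      using I y by (intro comb_cong) auto
    then show ?thesis using comb_insert[OF y I] by simp
  qed
  have "indep p e I y"
    unfolding indep_def
  proof (intro conjI allI)
    show "y \<in> I \<rightarrow> carrier G" using y by auto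
    fix k
    have "comb I y k = comb (insert i I) y (k(i := 0))"
      using y unfolding ins by (auto simp: Pi_iff)
    then show "comb I y k = \<one> \<longleftrightarrow> (\<forall>j\<in>I. int p ^ e j dvd k j)"
      using L I by (auto simp: indep_def split: if_splits)
  qed
  moreover have "y i \<in> torsion (int p ^ e i)"
    using indep_torsion[OF L] I y by (auto simp: torsion_def)
  moreover have "y i [^] (int p ^ (e i - 1)) \<noteq> comb I y k" for k
  proof
    assume *: "y i [^] (int p ^ (e i - 1)) = comb I y k"
    have "comb (insert i I) y ((\<lambda>j. - k j)(i := int p ^ (e i - 1))) = \<one>"
      unfolding ins using * y by (subst comb_minus) auto
    then have "int p ^ e i dvd int p ^ (e i - 1)"
      using L unfolding indep_def by (metis fun_upd_same insertI1)
    then show False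
      using p ei prime_gt_1_nat[OF p] by (auto simp: dvd_power_iff)
  qed
  ultimately show ?R by auto
next
  assume R: ?R
  have y': "y \<in> I \<rightarrow> carrier G" "y i \<in> carrier G" using y by auto
  have tor: "y i [^] (int p ^ e i) = \<one>" using R by (simp add: torsion_def)
  have vanish: "y i [^] c = \<one>" if "int p ^ e i dvd c" for c
    using that tor y' by (metis dvdE int_pow_one int_pow_pow)
  have indep: "comb I y k = \<one> \<longleftrightarrow> (\<forall>i\<in>I. int p ^ e i dvd k i)" for k
    using R by (simp add: indep_def)
  show ?L
    unfolding indep_def
  proof (intro conjI allI y iffI)
    fix k assume "\<forall>j\<in>insert i I. int p ^ e j dvd k j"
    then show "comb (insert i I) y k = \<one>"
      using indep vanish y' by (simp add: comb_insert[OF y I])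
  next
    fix k assume k: "comb (insert i I) y k = \<one>"
    have "int p ^ e i dvd k i"
    \<comment> \<open>A coefficient \<open>k i = p ^ s * u\<close> with \<open>s < e i\<close> and
      \<open>u\<close> prime to \<open>p\<close> puts a nontrivial power of \<open>y i\<close> into
      the span; a further power of it is the forbidden element.\<close>
    proof (rule ccontr)
      assume nd: "\<not> int p ^ e i dvd k i"
      then have "k i \<noteq> 0" by auto
      then obtain u where u: "k i = int p ^ multiplicity (int p) (k i) * u" "\<not> int p dvd u"
        using p by (metis multiplicity_decompose' not_prime_unit prime_int_nat_transfer prime_nat_int_transfer)
      define s where "s = multiplicity (int p) (k i)"
      have "s < e i"
        using nd u unfolding s_def by (metis dvd_triv_left le_imp_power_dvd not_less dvd_trans)
      have "coprime u (int p ^ e i)"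
        using u(2) p prime_imp_coprime[of "int p" u] by (auto simp: coprime_commute)
      \<comment> \<open>\<open>v\<close> inverts \<open>u\<close> modulo \<open>p ^ e i\<close>, so
        raising the \<open>k i\<close>-th power of \<open>y i\<close> to
        \<open>p ^ (e i - 1 - s) * v\<close> gives exactly
        \<open>y i [^] (int p ^ (e i - 1))\<close>.\<close>
      then obtain v w where vw: "v * u + w * int p ^ e i = 1"
        by (metis bezout_int coprime_imp_gcd_eq_1)
      have "y i [^] (int p ^ (e i - 1)) = y i [^] (int p ^ (e i - 1) * v * u + int p ^ (e i - 1) * w * int p ^ e i)"
        using vw by (metis (no_types, lifting) distrib_left mult.assoc mult.right_neutral)
      also have "\<dots> = y i [^] (int p ^ (e i - 1) * v * u)"
        using y' vanish[of "int p ^ (e i - 1) * w * int p ^ e i"] by (simp add: int_pow_mult)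
      also have "int p ^ (e i - 1) * v * u = k i * (int p ^ (e i - 1 - s) * v)"
        using u(1) \<open>s < e i\<close> unfolding s_def[symmetric]
        by (simp add: mult_ac power_add[symmetric])
      also have "y i [^] \<dots> = (y i [^] k i) [^] (int p ^ (e i - 1 - s) * v)"
        using y' by (simp add: int_pow_pow)
      also have "y i [^] k i = inv (comb I y k)"
        using k y' unfolding comb_insert[OF y I] by (metis comb_closed inv_equality int_pow_closed)
      also have "\<dots> [^] (int p ^ (e i - 1 - s) * v) \<in> range (comb I y)"
        using y' I by (metis comb_minus comb_scale rangeI)
      finally show False using R by simp
    qed
    moreover from this have "comb I y k = \<one>"
      using k y' vanish by (simp add: comb_insert[OF y I])
    ultimately show "\<forall>j\<in>insert i I. int p ^ e j dvd k j"
      using indep by auto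
  qed
qed

text \<open>The power in question is killed by \<open>p\<close>, and the span contains
  \<open>p ^ card I\<close> such elements, the combinations with coefficients
  \<open>p ^ (e i - 1) * a i\<close>. Since \<open>c \<le> e i\<close>, each has a root of exponent
  \<open>p ^ (c - 1)\<close> in the span, and all its roots form a coset of the torsion of that
  exponent. The inequality is what forces members of smallest order to be added last.\<close>

lemma card_torsion_power_in_span:
  assumes p: "prime p" and I: "finite I" and fin: "finite (carrier G)"
    and y: "indep p e I y" and c: "0 < c" "\<And>i. i \<in> I \<Longrightarrow> c \<le> e i"
  shows "card {x \<in> torsion (int p ^ c). x [^] (int p ^ (c - 1)) \<in> range (comb I y)} =
    p ^ card I * card (torsion (int p ^ (c - 1)))" (is "card ?S = _")
proof -
  have yc: "y \<in> I \<rightarrow> carrier G" using y by (simp add: indep_def)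
  have p0: "int p > 0" using p prime_gt_0_nat by simp
  define C where "C = (\<Pi>\<^sub>E i\<in>I. {0..<int p})"
  \<comment> \<open>\<open>z a\<close> is the chosen root of the combination with coefficients
    \<open>p ^ (e i - 1) * a i\<close>.\<close>
  define z where "z a = comb I y (\<lambda>i. int p ^ (e i - c) * a i)" for a
  have zc: "z a \<in> carrier G" for a using yc by (simp add: z_def)
  have z_pow: "z a [^] (int p ^ (c - 1)) = comb I y (\<lambda>i. int p ^ (e i - 1) * a i)" for a
    unfolding z_def comb_scale[OF yc I, symmetric] using c
    by (intro comb_cong yc) (auto simp: mult.assoc[symmetric] power_add[symmetric])
  have z_pow': "z a [^] (int p ^ c) = \<one>" for a
  proof -
    have "z a [^] (int p ^ c) = comb I y (\<lambda>i. int p ^ c * (int p ^ (e i - c) * a i))"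
      unfolding z_def comb_scale[OF yc I] ..
    also have "\<dots> = \<one>"
      using y c by (auto simp: indep_def mult.assoc[symmetric] power_add[symmetric])
    finally show ?thesis .
  qed
  have tor_mono: "t [^] (int p ^ c) = \<one>" if "t [^] (int p ^ (c - 1)) = \<one>" "t \<in> carrier G" for t
  proof -
    have "t [^] (int p ^ c) = (t [^] (int p ^ (c - 1))) [^] int p"
      using c that(2) by (simp add: int_pow_pow power_Suc2[symmetric] del: power_Suc)
    then show ?thesis using that by simp
  qed
  have "bij_betw (\<lambda>(a, t). z a \<otimes> t) (C \<times> torsion (int p ^ (c - 1))) ?S"
    unfolding bij_betw_def
  proof (intro conjI inj_onI, clarify)
    fix a t a' t'
    assume a: "a \<in> C" "a' \<in> C" and t: "t \<in> torsion (int p ^ (c - 1))" "t' \<in> torsion (int p ^ (c - 1))"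
      and eq: "z a \<otimes> t = z a' \<otimes> t'"
    have "(z a \<otimes> t) [^] (int p ^ (c - 1)) = (z a' \<otimes> t') [^] (int p ^ (c - 1))"
      using eq by simp
    then have "comb I y (\<lambda>i. int p ^ (e i - 1) * a i) = comb I y (\<lambda>i. int p ^ (e i - 1) * a' i)"
      using t zc yc unfolding z_pow[symmetric] by (simp add: torsion_def int_pow_distrib)
    then have *: "[int p ^ (e i - 1) * a i = int p ^ (e i - 1) * a' i] (mod int p ^ (e i - 1) * int p)" if "i \<in> I" for i
    proof -
      have "Suc (e i - 1) = e i" using that c by fastforce
      moreover have "[int p ^ (e i - 1) * a i = int p ^ (e i - 1) * a' i] (mod int p ^ e i)"
        using \<open>comb I y _ = comb I y _\<close> that unfolding indep_comb_eq_iff[OF y] by blast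
      ultimately show ?thesis by (metis power_Suc2)
    qed
    have "a i = a' i" if "i \<in> I" for i
    proof -
      have "[a i = a' i] (mod int p)"
        using *[OF that] p0 by (simp add: cong_iff_dvd_diff right_diff_distrib[symmetric])
      then show ?thesis
        using a that by (intro cong_less_imp_eq_int) (auto simp: C_def PiE_iff)
    qed
    with a have "a = a'" unfolding C_def by (intro PiE_ext) auto
    with eq t zc show "a = a' \<and> t = t'" by (auto simp: torsion_def)
  next
    show "(\<lambda>(a, t). z a \<otimes> t) ` (C \<times> torsion (int p ^ (c - 1))) = ?S"
    proof safe
      fix a t assume t: "t \<in> torsion (int p ^ (c - 1))"
      show "z a \<otimes> t \<in> torsion (int p ^ c)"
        using t tor_mono zc by (auto simp: torsion_def int_pow_distrib z_pow')
      show "(z a \<otimes> t) [^] (int p ^ (c - 1)) \<in> range (comb I y)"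
      proof -
        have "(z a \<otimes> t) [^] (int p ^ (c - 1)) = z a [^] (int p ^ (c - 1))"
          using t zc by (simp add: torsion_def int_pow_distrib)
        then show ?thesis unfolding z_pow by simp
      qed
    next
      fix x k assume x: "x \<in> torsion (int p ^ c)" and k: "x [^] (int p ^ (c - 1)) = comb I y k"
      have xc: "x \<in> carrier G" using x by (simp add: torsion_def)
      have "comb I y (\<lambda>i. int p * k i) = (x [^] (int p ^ (c - 1))) [^] int p"
        unfolding comb_scale[OF yc I] k ..
      also have "\<dots> = x [^] (int p ^ c)"
        using c xc by (simp add: int_pow_pow power_Suc2[symmetric] del: power_Suc)
      also have "\<dots> = \<one>" using x by (simp add: torsion_def)
      finally have "\<forall>i\<in>I. int p ^ e i dvd int p * k i" using y by (simp add: indep_def)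
      have "\<exists>b. k i = int p ^ (e i - 1) * b" if "i \<in> I" for i
      proof -
        have "Suc (e i - 1) = e i" using that c by fastforce
        then have "int p * int p ^ (e i - 1) dvd int p * k i"
          using \<open>\<forall>i\<in>I. int p ^ e i dvd int p * k i\<close> that by (metis power_Suc)
        then show ?thesis using p0 by auto
      qed
      then obtain b where b: "\<And>i. i \<in> I \<Longrightarrow> k i = int p ^ (e i - 1) * b i" by metis
      define a where "a = (\<lambda>i\<in>I. b i mod int p)"
      have a: "a \<in> C" using p0 by (auto simp: a_def C_def)
      have "comb I y k = comb I y (\<lambda>i. int p ^ (e i - 1) * a i)"
        unfolding indep_comb_eq_iff[OF y]
      proof
        fix i assume i: "i \<in> I"
        have "Suc (e i - 1) = e i" using i c by fastforce
        then have "int p ^ e i = int p ^ (e i - 1) * int p"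
          by (metis power_Suc2)
        then show "[k i = int p ^ (e i - 1) * a i] (mod int p ^ e i)"
          using i by (simp add: b a_def cong_def)
      qed
      then have xz: "x [^] (int p ^ (c - 1)) = z a [^] (int p ^ (c - 1))"
        unfolding z_pow k .
      define t where "t = inv (z a) \<otimes> x"
      have "t \<in> torsion (int p ^ (c - 1))"
        using zc xc xz by (simp add: t_def torsion_def int_pow_distrib int_pow_inv)
      moreover have "x = z a \<otimes> t"
        using zc xc by (simp add: t_def m_assoc[symmetric])
      ultimately show "x \<in> (\<lambda>(a, t). z a \<otimes> t) ` (C \<times> torsion (int p ^ (c - 1)))"
        using a by (intro image_eqI[where x = "(a, t)"]) simp_all
    qed
  qed
  then have "card ?S = card C * card (torsion (int p ^ (c - 1)))"
    by (simp only: bij_betw_same_card[symmetric] card_cartesian_product)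
  also have "card C = p ^ card I" using I by (simp add: C_def card_PiE)
  finally show ?thesis .
qed

text \<open>In basis coordinates, being killed by \<open>p ^ c\<close> means that the
  \<open>i\<close>-th coordinate is a multiple of \<open>p ^ (e i - min (e i) c)\<close>, which
  leaves \<open>p ^ min (e i) c\<close> residues.\<close>

lemma card_torsion:
  assumes p: "prime p" and I: "finite I" and b: "basis p e I b"
  shows "card (torsion (int p ^ c)) = p ^ (\<Sum>i\<in>I. min (e i) c)"
proof -
  have ind: "indep p e I b" and bc: "b \<in> I \<rightarrow> carrier G"
    using b by (auto simp: basis_def indep_def)
  have p0: "int p > 0" using p prime_gt_0_nat by simp
  define m where "m i = min (e i) c" for i
  have m: "int p ^ e i = int p ^ (e i - m i) * int p ^ m i" for i
    by (simp add: m_def power_add[symmetric])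
  define C where "C = (\<Pi>\<^sub>E i\<in>I. {0..<int p ^ m i})"
  have "bij_betw (\<lambda>a. comb I b (\<lambda>i. int p ^ (e i - m i) * a i)) C (torsion (int p ^ c))"
    unfolding bij_betw_def
  proof (intro conjI inj_onI)
    fix a a' assume a: "a \<in> C" "a' \<in> C"
      and eq: "comb I b (\<lambda>i. int p ^ (e i - m i) * a i) = comb I b (\<lambda>i. int p ^ (e i - m i) * a' i)"
    have "a i = a' i" if "i \<in> I" for i
    proof -
      have "[int p ^ (e i - m i) * a i = int p ^ (e i - m i) * a' i] (mod int p ^ (e i - m i) * int p ^ m i)"
        using eq that unfolding indep_comb_eq_iff[OF ind] m[of i, symmetric] by blast
      then have "[a i = a' i] (mod int p ^ m i)"
        using p0 by (simp add: cong_iff_dvd_diff right_diff_distrib[symmetric])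
      then show ?thesis
        using a that by (intro cong_less_imp_eq_int) (auto simp: C_def PiE_iff)
    qed
    with a show "a = a'" unfolding C_def by (intro PiE_ext) auto
  next
    show "(\<lambda>a. comb I b (\<lambda>i. int p ^ (e i - m i) * a i)) ` C = torsion (int p ^ c)"
    proof safe
      fix a assume "a \<in> C"
      have "comb I b (\<lambda>i. int p ^ c * (int p ^ (e i - m i) * a i)) = \<one>"
      proof -
        have "int p ^ e i dvd int p ^ c * (int p ^ (e i - m i) * a i)" for i
          by (cases "e i \<le> c") (simp_all add: m_def mult.assoc[symmetric] power_add[symmetric] le_imp_power_dvd)
        then show ?thesis using ind by (simp add: indep_def)
      qed
      then show "comb I b (\<lambda>i. int p ^ (e i - m i) * a i) \<in> torsion (int p ^ c)"
        using bc by (simp add: torsion_def comb_scale[OF bc I])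
    next
      fix x assume x: "x \<in> torsion (int p ^ c)"
      then obtain k where k: "x = comb I b k" using b by (auto simp: basis_def torsion_def)
      have "comb I b (\<lambda>i. int p ^ c * k i) = \<one>"
        using x unfolding comb_scale[OF bc I] by (simp add: torsion_def k)
      then have dv: "int p ^ e i dvd int p ^ c * k i" if "i \<in> I" for i
        using ind that by (simp add: indep_def)
      have "int p ^ (e i - m i) dvd k i" if "i \<in> I" for i
      proof (cases "e i \<le> c")
        case False
        then have "int p ^ c * int p ^ (e i - c) dvd int p ^ c * k i"
          using dv[OF that] by (simp add: power_add[symmetric])
        then show ?thesis using False p0 by (simp add: m_def)
      qed (simp add: m_def)
      then have "\<forall>i\<in>I. \<exists>c. k i = int p ^ (e i - m i) * c"
        by (auto simp: dvd_def)
      then obtain q where q: "\<And>i. i \<in> I \<Longrightarrow> k i = int p ^ (e i - m i) * q i"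
        by metis
      define a where "a = (\<lambda>i\<in>I. q i mod int p ^ m i)"
      have "a \<in> C" using p0 by (auto simp: a_def C_def)
      moreover have "x = comb I b (\<lambda>i. int p ^ (e i - m i) * a i)"
        unfolding k indep_comb_eq_iff[OF ind]
      proof
        fix i assume "i \<in> I"
        then show "[k i = int p ^ (e i - m i) * a i] (mod int p ^ e i)"
          unfolding m[of i] by (simp add: q a_def cong_def)
      qed
      ultimately show "x \<in> (\<lambda>a. comb I b (\<lambda>i. int p ^ (e i - m i) * a i)) ` C" by blast
    qed
  qed
  then have "card (torsion (int p ^ c)) = card C" by (simp add: bij_betw_same_card)
  also have "\<dots> = p ^ (\<Sum>i\<in>I. min (e i) c)"
    using I by (simp add: C_def card_PiE m_def power_sum nat_power_eq)
  finally show ?thesis .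
qed

definition indep_families :: "nat \<Rightarrow> ('i \<Rightarrow> nat) \<Rightarrow> 'i set \<Rightarrow> ('i \<Rightarrow> 'a) set" where
  "indep_families p e I = {y \<in> I \<rightarrow>\<^sub>E carrier G. indep p e I y}"

text \<open>Given an independent family on \<open>I\<close>, the new member may be any element of
  the torsion outside the set just counted, whose size does not depend on the family. Real numbers
  avoid truncated subtraction.\<close>

lemma card_indep_families_insert:
  assumes p: "prime p" and fin: "finite (carrier G)" and I: "finite I" "i \<notin> I"
    and ei: "e i > 0" "\<And>j. j \<in> I \<Longrightarrow> e i \<le> e j"
  shows "real (card (indep_families p e (insert i I))) = real (card (indep_families p e I)) *
    (real (card (torsion (int p ^ e i))) - real p ^ card I * real (card (torsion (int p ^ (e i - 1)))))"
proof -
  define B where "B y = {x \<in> torsion (int p ^ e i). x [^] (int p ^ (e i - 1)) \<in> range (comb I y)}" for y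
  define A where "A y = torsion (int p ^ e i) - B y" for y
  have fint: "finite (torsion n)" for n using fin by (simp add: torsion_def)
  have finf: "finite (indep_families p e I)"
    using fin I by (auto simp: indep_families_def intro!: finite_PiE)
  have upd: "indep p e (insert i I) (y(i := x)) \<longleftrightarrow> indep p e I y \<and> x \<in> A y"
    if "y \<in> I \<rightarrow> carrier G" "x \<in> carrier G" for x y
  proof -
    have "indep p e I (y(i := x)) = indep p e I y"
      using I by (metis fun_upd_other indep_cong)
    moreover have "comb I (y(i := x)) = comb I y"
      using I that by (intro ext comb_cong) auto
    ultimately show ?thesis
      using that by (subst indep_insert_iff[where e = e, OF p I ei(1)]) (auto simp: A_def B_def)
  qed
  have "bij_betw (\<lambda>(y, x). y(i := x)) (Sigma (indep_families p e I) A) (indep_families p e (insert i I))"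
    unfolding bij_betw_def
  proof
    show "inj_on (\<lambda>(y, x). y(i := x)) (Sigma (indep_families p e I) A)"
    proof (intro inj_onI, clarify)
      fix y x y' x' assume y: "y \<in> indep_families p e I" "y' \<in> indep_families p e I"
        and eq: "y(i := x) = y'(i := x')"
      have "y j = y' j" if "j \<in> I" for j using fun_cong[OF eq, of j] that I by (auto split: if_splits)
      with y have "y = y'" unfolding indep_families_def by (intro PiE_ext[where k = I and s = "\<lambda>_. carrier G"]) auto
      with fun_cong[OF eq, of i] show "y = y' \<and> x = x'" by simp
    qed
    show "(\<lambda>(y, x). y(i := x)) ` Sigma (indep_families p e I) A = indep_families p e (insert i I)"
    proof safe
      fix y x assume "y \<in> indep_families p e I" "x \<in> A y"
      then show "y(i := x) \<in> indep_families p e (insert i I)"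
        using upd[of y x] by (auto simp: indep_families_def A_def torsion_def PiE_iff extensional_def)
    next
      fix z assume z: "z \<in> indep_families p e (insert i I)"
      define y where "y = restrict z I"
      have zz: "z = y(i := z i)"
        using z by (auto simp: y_def indep_families_def fun_eq_iff PiE_iff extensional_def)
      have "y \<in> I \<rightarrow> carrier G" "z i \<in> carrier G" using z by (auto simp: indep_families_def y_def)
      from upd[OF this] z zz have "indep p e I y" "z i \<in> A y" by (auto simp: indep_families_def)
      moreover have "y \<in> I \<rightarrow>\<^sub>E carrier G" using z by (auto simp: y_def indep_families_def)
      ultimately have "(y, z i) \<in> Sigma (indep_families p e I) A" by (auto simp: indep_families_def)
      then show "z \<in> (\<lambda>(y, x). y(i := x)) ` Sigma (indep_families p e I) A"
        using zz by (metis (mono_tags, lifting) case_prod_conv image_iff)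
    qed
  qed
  then have "card (indep_families p e (insert i I)) = (\<Sum>y\<in>indep_families p e I. card (A y))"
    using finf fint by (auto simp: bij_betw_same_card[symmetric] A_def)
  also have "real \<dots> = (\<Sum>y\<in>indep_families p e I.
      real (card (torsion (int p ^ e i))) - real p ^ card I * real (card (torsion (int p ^ (e i - 1)))))"
    unfolding of_nat_sum
  proof (rule sum.cong)
    fix y assume "y \<in> indep_families p e I"
    then have y: "indep p e I y" by (simp add: indep_families_def)
    have B: "B y \<subseteq> torsion (int p ^ e i)" by (auto simp: B_def)
    then have "card (B y) \<le> card (torsion (int p ^ e i))" using fint by (intro card_mono)
    moreover have "card (A y) = card (torsion (int p ^ e i)) - card (B y)"
      unfolding A_def using B fint by (meson card_Diff_subset finite_subset)
    moreover have "card (B y) = p ^ card I * card (torsion (int p ^ (e i - 1)))"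
      unfolding B_def by (rule card_torsion_power_in_span[OF p I(1) fin y ei])
    ultimately show "real (card (A y)) = real (card (torsion (int p ^ e i))) - real p ^ card I * real (card (torsion (int p ^ (e i - 1))))"
      by (simp add: of_nat_diff)
  qed simp
  finally show ?thesis by simp
qed

text \<open>
  The families are built up by adding a member of smallest order last. The factor for the
  \<open>k\<close>-th member of order \<open>p\<^sup>d\<close> is then the proportion of elements of the \<open>p\<^sup>d\<close>-torsion that are
  independent of the \<open>card {j \<in> I. d < e j} + k\<close> earlier ones.
\<close>

lemma card_indep_families:
  fixes e :: "'i \<Rightarrow> nat" and t :: real
  assumes p: "prime p" and fin: "finite (carrier G)" and I: "finite I" and e: "\<And>i. i \<in> I \<Longrightarrow> e i > 0"
    and t: "\<And>c. c > 0 \<Longrightarrow> real (card (torsion (int p ^ (c - 1)))) = real (card (torsion (int p ^ c))) * t ^ r c"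
  shows "real (card (indep_families p e I)) = (\<Prod>i\<in>I. real (card (torsion (int p ^ e i)))) *
    (\<Prod>d\<in>e ` I. \<Prod>k<card {i \<in> I. e i = d}. 1 - t ^ r d * real p ^ (card {j \<in> I. d < e j} + k))"
  using I e
\<comment> \<open>The rule inserts an element of largest rank, so negating \<open>e\<close> makes it
  one of smallest order. It may already lie in \<open>I\<close>, whence the case
  distinction.\<close>
proof (induction I rule: finite_ranking_induct[where f = "\<lambda>i. - int (e i)"])
  case empty
  have "indep_families p e {} = {\<lambda>x. undefined}" by (auto simp: indep_families_def indep_empty)
  then show ?case by simp
next
  case (insert i I)
  show ?case
  proof (cases "i \<in> I")
    case True
    then show ?thesis using insert by (simp add: insert_absorb)
  next
    case False
    have le: "e i \<le> e j" if "j \<in> I" for j using insert(2)[OF that] by simp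
    have ei: "e i > 0" using insert by simp
    define W where "W J d = (\<Prod>k<card {i \<in> J. e i = d}. 1 - t ^ r d * real p ^ (card {j \<in> J. d < e j} + k))" for J d
    have "insert i {j \<in> I. e j = e i} = {j \<in> insert i I. e j = e i}" by auto
    moreover have "card (insert i {j \<in> I. e j = e i}) = Suc (card {j \<in> I. e j = e i})"
      using False insert(1) by simp
    ultimately have cS: "card {j \<in> insert i I. e j = e i} = Suc (card {j \<in> I. e j = e i})" by simp
    have gt: "{j \<in> insert i I. e i < e j} = {j \<in> I. e i < e j}" by auto
    \<comment> \<open>By minimality of \<open>e i\<close> the earlier members of larger or equal
      order are all of \<open>I\<close>, so the new factor, with \<open>k\<close> the old
      multiplicity, has exponent \<open>card I\<close>.\<close>
    have "e i < e j \<or> e j = e i" if "j \<in> I" for j using le[OF that] by linarith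
    then have "I = {j \<in> I. e i < e j} \<union> {j \<in> I. e j = e i}" by auto
    moreover have "card ({j \<in> I. e i < e j} \<union> {j \<in> I. e j = e i}) = card {j \<in> I. e i < e j} + card {j \<in> I. e j = e i}"
      using insert(1) by (intro card_Un_disjoint) auto
    ultimately have "card I = card {j \<in> I. e i < e j} + card {j \<in> I. e j = e i}" by simp
    then have W1: "W (insert i I) (e i) = W I (e i) * (1 - t ^ r (e i) * real p ^ card I)"
      unfolding W_def cS gt by simp
    have W2: "W (insert i I) d = W I d" if "d \<in> e ` I" "d \<noteq> e i" for d
    proof -
      have "{j \<in> insert i I. e j = d} = {j \<in> I. e j = d}" "{j \<in> insert i I. d < e j} = {j \<in> I. d < e j}"
        using that le by (auto simp: not_less[symmetric])
      then show ?thesis by (simp add: W_def)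
    qed
    have W0: "W I (e i) = 1" if "e i \<notin> e ` I"
    proof -
      have "{j \<in> I. e j = e i} = {}" using that by (metis (mono_tags, lifting) Collect_empty_eq image_eqI)
      then show ?thesis unfolding W_def by (metis card.empty lessThan_0 prod.empty)
    qed
    have "(\<Prod>d\<in>e ` insert i I. W (insert i I) d) = (\<Prod>d\<in>insert (e i) (e ` I - {e i}). W (insert i I) d)"
      by (rule prod.cong) auto
    also have "\<dots> = W (insert i I) (e i) * (\<Prod>d\<in>e ` I - {e i}. W I d)"
      using insert(1) W2 by (subst prod.insert) auto
    also have "\<dots> = (1 - t ^ r (e i) * real p ^ card I) * (W I (e i) * (\<Prod>d\<in>e ` I - {e i}. W I d))"
      by (simp add: W1)
    also have "W I (e i) * (\<Prod>d\<in>e ` I - {e i}. W I d) = (\<Prod>d\<in>e ` I. W I d)"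
      using insert(1) W0 by (cases "e i \<in> e ` I") (auto simp: prod.remove)
    finally have W: "(\<Prod>d\<in>e ` insert i I. W (insert i I) d) =
      (1 - t ^ r (e i) * real p ^ card I) * (\<Prod>d\<in>e ` I. W I d)" .
    have IH: "real (card (indep_families p e I)) = (\<Prod>i\<in>I. real (card (torsion (int p ^ e i)))) * (\<Prod>d\<in>e ` I. W I d)"
      unfolding W_def using insert by auto
    have "real (card (indep_families p e (insert i I))) = real (card (indep_families p e I)) *
      (real (card (torsion (int p ^ e i))) * (1 - t ^ r (e i) * real p ^ card I))"
      using card_indep_families_insert[where e = e, OF p fin insert(1) False ei le] t[OF ei]
      by (simp add: algebra_simps)
    also have "\<dots> = (\<Prod>i\<in>insert i I. real (card (torsion (int p ^ e i)))) * (\<Prod>d\<in>e ` insert i I. W (insert i I) d)"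
      unfolding IH W using False insert(1) by simp
    finally show ?thesis unfolding W_def .
  qed
qed

end

section \<open>Automorphisms\<close>

lemma hom_comb:
  assumes "comm_group G" "comm_group H" "h \<in> hom G H" "b \<in> I \<rightarrow> carrier G" "finite I"
  shows "h (comm_group.comb G I b k) = comm_group.comb H I (h \<circ> b) k"
  using assms(5,4)
proof (induction I)
  case empty
  then show ?case
    using hom_one[OF assms(3) comm_group.axioms(2)[OF assms(1)] comm_group.axioms(2)[OF assms(2)]] assms(1,2)
    by (simp add: comm_group.comb_def comm_monoid.finprod_empty comm_group.axioms(1))
next
  case (insert i I)
  have b: "b \<in> I \<rightarrow> carrier G" "b i \<in> carrier G" using insert by auto
  have "h \<circ> b \<in> insert i I \<rightarrow> carrier H" using insert assms(3) by (auto simp: hom_def Pi_iff)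
  then have "comm_group.comb H (insert i I) (h \<circ> b) k = h (b i) [^]\<^bsub>H\<^esub> k i \<otimes>\<^bsub>H\<^esub> comm_group.comb H I (h \<circ> b) k"
    using comm_group.comb_insert[OF assms(2), of "h \<circ> b"] insert by simp
  also have "h (b i) [^]\<^bsub>H\<^esub> k i = h (b i [^]\<^bsub>G\<^esub> k i)"
    using hom_int_pow[OF assms(3) b(2)] assms comm_group.axioms(2) by metis
  also have "comm_group.comb H I (h \<circ> b) k = h (comm_group.comb G I b k)"
    using insert b by (simp add: o_def)
  also have "h (b i [^]\<^bsub>G\<^esub> k i) \<otimes>\<^bsub>H\<^esub> \<dots> = h (b i [^]\<^bsub>G\<^esub> k i \<otimes>\<^bsub>G\<^esub> comm_group.comb G I b k)"
    using assms(1,3) b comm_group.comb_closed[OF assms(1)] group.int_pow_closed comm_group.axioms(2)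
    by (metis hom_mult)
  also have "b i [^]\<^bsub>G\<^esub> k i \<otimes>\<^bsub>G\<^esub> comm_group.comb G I b k = comm_group.comb G (insert i I) b k"
    using comm_group.comb_insert[OF assms(1)] insert by metis
  finally show ?case ..
qed

lemma basis_iso:
  assumes "comm_group G" "comm_group H" "h \<in> iso G H" "finite I" "comm_group.basis G p e I b"
  shows "comm_group.basis H p e I (h \<circ> b)"
proof -
  interpret G: comm_group G by fact
  interpret H: comm_group H by fact
  have h: "h \<in> hom G H" "bij_betw h (carrier G) (carrier H)" using assms by (auto simp: iso_def)
  have b: "b \<in> I \<rightarrow> carrier G" using assms by (simp add: G.basis_def G.indep_def)
  have comb: "H.comb I (h \<circ> b) k = h (G.comb I b k)" for k
    using hom_comb assms(1,2,4) h(1) b by metis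
  have "h (G.comb I b k) = \<one>\<^bsub>H\<^esub> \<longleftrightarrow> G.comb I b k = \<one>\<^bsub>G\<^esub>" for k
    using h(2) b hom_one[OF h(1)] G.comb_closed[OF b]
    by (metis G.one_closed H.is_group G.is_group bij_betw_inv_into_left)
  moreover have "\<exists>k. x = h (G.comb I b k)" if "x \<in> carrier H" for x
    using that h(2) assms(5) unfolding G.basis_def by (metis bij_betw_inv_into_right bij_betwE bij_betw_inv_into)
  moreover have "h \<circ> b \<in> I \<rightarrow> carrier H" using b h(1) by (auto simp: hom_def)
  ultimately show ?thesis
    using assms(5) unfolding H.basis_def H.indep_def comb G.basis_def G.indep_def by simp
qed

context comm_group
begin

text \<open>Automorphisms correspond to the images of the basis. Conversely, an independent family
  with the same orders satisfies exactly the same relations as the basis, so it defines an injective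
  endomorphism, which is onto because the group is finite.\<close>

lemma card_auto:
  assumes p: "prime p" and fin: "finite (carrier G)" and I: "finite I" and b: "basis p e I b"
  shows "card (auto G) = card (indep_families p e I)"
proof -
  have ind: "indep p e I b" and bc: "b \<in> I \<rightarrow> carrier G"
    and span: "\<And>x. x \<in> carrier G \<Longrightarrow> \<exists>k. x = comb I b k"
    using b by (auto simp: basis_def indep_def)
  have hcomb: "h (comb I b k) = comb I (\<lambda>i\<in>I. h (b i)) k" if "h \<in> hom G G" for h k
  proof -
    have "h (comb I b k) = comb I (h \<circ> b) k"
      using hom_comb[OF comm_group_axioms comm_group_axioms that bc I] .
    also have "\<dots> = comb I (\<lambda>i\<in>I. h (b i)) k"
      using that bc by (intro comb_cong) (auto simp: hom_def Pi_iff)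
    finally show ?thesis .
  qed
  have "bij_betw (\<lambda>h. \<lambda>i\<in>I. h (b i)) (auto G) (indep_families p e I)"
    unfolding bij_betw_def
  proof (intro conjI inj_onI)
    fix h h' assume h: "h \<in> auto G" "h' \<in> auto G" and eq: "(\<lambda>i\<in>I. h (b i)) = (\<lambda>i\<in>I. h' (b i))"
    show "h = h'"
    proof (rule extensionalityI)
      show "h \<in> extensional (carrier G)" "h' \<in> extensional (carrier G)"
        using h by (auto simp: auto_def Bij_def)
      fix x assume "x \<in> carrier G"
      then obtain k where "x = comb I b k" using span by blast
      then show "h x = h' x" using hcomb[of h k] hcomb[of h' k] h eq by (simp add: auto_def)
    qed
  next
    show "(\<lambda>h. \<lambda>i\<in>I. h (b i)) ` auto G = indep_families p e I"
    proof safe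
      fix h assume "h \<in> auto G"
      then have h: "h \<in> hom G G" "bij_betw h (carrier G) (carrier G)" by (auto simp: auto_def Bij_def)
      have "comb I (\<lambda>i\<in>I. h (b i)) k = \<one> \<longleftrightarrow> comb I b k = \<one>" for k
        unfolding hcomb[OF h(1), symmetric]
        using h(2) hom_one[OF h(1)] comb_closed[OF bc]
        by (metis one_closed is_group bij_betw_inv_into_left)
      then show "(\<lambda>i\<in>I. h (b i)) \<in> indep_families p e I"
        using ind h(1) bc by (auto simp: indep_families_def indep_def hom_def Pi_iff)
    next
      fix y assume y: "y \<in> indep_families p e I"
      then have yi: "indep p e I y" and yc: "y \<in> I \<rightarrow> carrier G" by (auto simp: indep_families_def)
      have eq: "comb I y k = comb I y m \<longleftrightarrow> comb I b k = comb I b m" for k m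
        unfolding indep_comb_eq_iff[OF yi] indep_comb_eq_iff[OF ind] ..
      \<comment> \<open>The choice of coefficients is harmless: by \<open>eq\<close>, coefficients
        that agree on \<open>b\<close> also agree on \<open>y\<close>.\<close>
      define h where "h = (\<lambda>x\<in>carrier G. comb I y (SOME k. x = comb I b k))"
      have h: "h (comb I b k) = comb I y k" for k
      proof -
        have "comb I b k = comb I b (SOME m. comb I b k = comb I b m)" by (rule someI[where P = "\<lambda>m. comb I b k = comb I b m"]) (rule refl)
        then show ?thesis using bc eq by (simp add: h_def)
      qed
      have hom: "h \<in> hom G G"
      proof (rule homI)
        fix x x' assume "x \<in> carrier G" "x' \<in> carrier G"
        then obtain k k' where k: "x = comb I b k" "x' = comb I b k'" using span by metis
        show "h x \<in> carrier G" using k h yc by simp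
        have "x \<otimes> x' = comb I b (\<lambda>i. k i + k' i)" by (simp add: comb_add bc k)
        then show "h (x \<otimes> x') = h x \<otimes> h x'" using k h by (simp add: comb_add yc)
      qed
      have "inj_on h (carrier G)"
        by (intro inj_onI) (metis span h eq)
      moreover have "h ` carrier G \<subseteq> carrier G" using hom by (auto simp: hom_def)
      ultimately have "bij_betw h (carrier G) (carrier G)"
        using fin by (simp add: bij_betw_def endo_inj_surj)
      with hom have "h \<in> auto G" by (simp add: auto_def Bij_def h_def)
      moreover have "y = (\<lambda>i\<in>I. h (b i))"
      proof (rule extensionalityI)
        show "y \<in> extensional I" using y by (auto simp: indep_families_def PiE_def)
        fix i assume i: "i \<in> I"
        have "b i = comb I b (\<lambda>j. if j = i then 1 else 0)"
          using comb_single[OF bc I i, of 1] funcset_mem[OF bc i] by simp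
        then have "h (b i) = comb I y (\<lambda>j. if j = i then 1 else 0)" using h by metis
        also have "\<dots> = y i" using comb_single[OF yc I i, of 1] funcset_mem[OF yc i] by simp
        finally show "y i = (\<lambda>i\<in>I. h (b i)) i" using i by simp
      qed simp
      ultimately show "y \<in> (\<lambda>h. \<lambda>i\<in>I. h (b i)) ` auto G" by blast
    qed
  qed
  then show ?thesis by (rule bij_betw_same_card)
qed

end

definition aut_size :: "nat \<Rightarrow> nat multiset \<Rightarrow> real" where
  "aut_size p l = real p ^ (\<Sum>x\<in>#l. \<Sum>y\<in>#l. min x y) * (\<Prod>d\<in>set_mset l. qpoch (1 / real p) (count l d))"

lemma (in comm_group) order_AutoGroup:
  assumes p: "prime p" and fin: "finite (carrier G)" and I: "finite I" and b: "basis p e I b"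
    and e: "\<And>i. i \<in> I \<Longrightarrow> 0 < e i"
  shows "real (order (AutoGroup G)) = aut_size p (image_mset e (mset_set I))"
proof -
  define t :: real where "t = 1 / real p"
  have p0: "real p > 0" using p prime_gt_0_nat by simp
  have pt: "real p * t = 1" "t * real p = 1" using p0 by (simp_all add: t_def)
  \<comment> \<open>\<open>r d\<close> is the length of the \<open>d\<close>-th column of the
    diagram; passing from \<open>p ^ c\<close>-torsion to \<open>p ^ (c - 1)\<close>-torsion divides
    the cardinality by \<open>p ^ r c\<close>.\<close>
  define r where "r d = card {i \<in> I. d \<le> e i}" for d
  define l where "l = image_mset e (mset_set I)"
  have cnt: "count l d = card {i \<in> I. e i = d}" for d
    using I by (auto simp: l_def count_image_mset intro!: arg_cong[where f = card])
  have r: "r d = card {i \<in> I. d < e i} + count l d" for d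
    unfolding cnt r_def using I
    by (subst card_Un_disjoint[symmetric]) (auto intro!: arg_cong[where f = card])
  have "real (card (torsion (int p ^ (c - 1)))) = real (card (torsion (int p ^ c))) * t ^ r c" if "c > 0" for c
  proof -
    have "(\<Sum>i\<in>I. min (e i) c) = (\<Sum>i\<in>I. min (e i) (c - 1) + (if c \<le> e i then 1 else 0))"
      using that by (intro sum.cong) auto
    also have "\<dots> = (\<Sum>i\<in>I. min (e i) (c - 1)) + r c"
      using I by (simp add: sum.distrib r_def sum.If_cases Int_def)
    finally show ?thesis
      using pt by (simp add: card_torsion[OF p I b] power_add mult.assoc flip: power_mult_distrib)
  qed
  then have "real (card (auto G)) = (\<Prod>i\<in>I. real (card (torsion (int p ^ e i)))) *
    (\<Prod>d\<in>e ` I. \<Prod>k<card {i \<in> I. e i = d}. 1 - t ^ r d * real p ^ (card {j \<in> I. d < e j} + k))"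
    unfolding card_auto[OF p fin I b] by (intro card_indep_families p fin I e)
  also have "(\<Prod>i\<in>I. real (card (torsion (int p ^ e i)))) = real p ^ (\<Sum>x\<in>#l. \<Sum>y\<in>#l. min x y)"
  proof -
    have "(\<Sum>x\<in>#l. \<Sum>y\<in>#l. min x y) = (\<Sum>i\<in>I. \<Sum>j\<in>I. min (e i) (e j))"
      by (simp add: l_def sum_unfold_sum_mset multiset.map_comp o_def)
    also have "\<dots> = (\<Sum>i\<in>I. \<Sum>j\<in>I. min (e j) (e i))"
      by (simp add: min.commute)
    finally show ?thesis
      by (simp add: card_torsion[OF p I b] power_sum)
  qed
  also have "(\<Prod>d\<in>e ` I. \<Prod>k<card {i \<in> I. e i = d}. 1 - t ^ r d * real p ^ (card {j \<in> I. d < e j} + k)) =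
    (\<Prod>d\<in>e ` I. qpoch t (count l d))"
  proof (rule prod.cong)
    fix d
    \<comment> \<open>Since \<open>r d\<close> is the number of larger parts plus
      \<open>count l d\<close>, the powers of \<open>p\<close> and \<open>t\<close> cancel to
      \<open>t ^ (count l d - k)\<close>. These are the factors of \<open>qpoch\<close> in reverse
      order.\<close>
    have "1 - t ^ r d * real p ^ (card {j \<in> I. d < e j} + k) = 1 - t ^ Suc (count l d - Suc k)"
      if "k < count l d" for k
    proof -
      have rd: "r d = (card {j \<in> I. d < e j} + k) + Suc (count l d - Suc k)" using that by (simp add: r)
      then have "t ^ r d * real p ^ (card {j \<in> I. d < e j} + k) =
        (t * real p) ^ (card {j \<in> I. d < e j} + k) * t ^ Suc (count l d - Suc k)"
        unfolding rd power_add power_mult_distrib by (simp only: mult_ac)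
      then show ?thesis by (simp add: pt)
    qed
    then have "(\<Prod>k<count l d. 1 - t ^ r d * real p ^ (card {j \<in> I. d < e j} + k)) =
      (\<Prod>k<count l d. 1 - t ^ Suc (count l d - Suc k))"
      by (intro prod.cong) auto
    also have "\<dots> = qpoch t (count l d)"
      unfolding qpoch_def by (rule prod.nat_diff_reindex)
    finally show "(\<Prod>k<card {i \<in> I. e i = d}. 1 - t ^ r d * real p ^ (card {j \<in> I. d < e j} + k)) = qpoch t (count l d)"
      by (simp add: cnt)
  qed simp
  finally show ?thesis
    using I by (simp add: aut_size_def l_def t_def order_def AutoGroup_def)
qed

section \<open>Products of cyclic groups\<close>

lemma comm_group_product_group:
  assumes "\<And>i. i \<in> I \<Longrightarrow> comm_group (G i)"
  shows "comm_group (product_group I G)"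
proof (rule group.group_comm_groupI)
  show "group (product_group I G)"
    by (intro product_group comm_group.axioms(2) assms)
  fix x y assume "x \<in> carrier (product_group I G)" "y \<in> carrier (product_group I G)"
  then show "x \<otimes>\<^bsub>product_group I G\<^esub> y = y \<otimes>\<^bsub>product_group I G\<^esub> x"
    using assms by (auto intro!: restrict_ext comm_monoid.m_comm comm_group.axioms(1) simp: PiE_iff)
qed

lemma int_pow_product_group:
  assumes "\<And>i. i \<in> I \<Longrightarrow> group (G i)" "x \<in> carrier (product_group I G)" "i \<in> I"
  shows "(x [^]\<^bsub>product_group I G\<^esub> (n :: int)) i = x i [^]\<^bsub>G i\<^esub> n"
proof -
  have "(\<lambda>x. x i) \<in> hom (product_group I G) (G i)"
    using assms(3) by (auto intro!: homI)
  from hom_int_pow[OF this assms(2), of n] show ?thesis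
    using assms(1,3) by simp
qed

text \<open>The entry is \<open>1 mod int p ^ e i\<close> because for \<open>e i = 0\<close> the
  factor is trivial and its only element is 0.\<close>

definition unit_vec :: "nat \<Rightarrow> ('i \<Rightarrow> nat) \<Rightarrow> 'i set \<Rightarrow> 'i \<Rightarrow> 'i \<Rightarrow> int" where
  "unit_vec p e I i = (\<lambda>j\<in>I. if j = i then 1 mod int p ^ e i else 0)"

lemma basis_product_group:
  fixes e :: "'i \<Rightarrow> nat"
  assumes p: "p > 0" and I: "finite I"
  defines "G \<equiv> product_group I (\<lambda>i. integer_mod_group (p ^ e i))"
  shows "comm_group.basis G p e I (unit_vec p e I)"
proof -
  interpret comm_group G unfolding G_def by (rule comm_group_product_group) simp
  have carr: "carrier G = (\<Pi>\<^sub>E i\<in>I. {0..<int p ^ e i})"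
    using p by (simp add: G_def carrier_integer_mod_group)
  have u: "unit_vec p e I \<in> I \<rightarrow> carrier G"
    using p by (auto simp: carr unit_vec_def)
  \<comment> \<open>Restricting the combination to \<open>J\<close> while the vectors keep all
    coordinates in \<open>I\<close> lets the induction fill in one coordinate at a time.\<close>
  have comb: "comb J (unit_vec p e I) k = (\<lambda>j\<in>I. if j \<in> J then k j mod int p ^ e j else 0)" if "J \<subseteq> I" for J k
    using finite_subset[OF that I] that
  proof (induction J)
    case empty
    then show ?case by (simp add: comb_def) (simp add: G_def restrict_def)
  next
    case (insert i J)
    have pow: "unit_vec p e I i [^]\<^bsub>G\<^esub> k i = (\<lambda>j\<in>I. if j = i then k i mod int p ^ e i else 0)"
    proof (rule extensionalityI)
      show "unit_vec p e I i [^]\<^bsub>G\<^esub> k i \<in> extensional I"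
        using int_pow_closed[OF funcset_mem[OF u], of i "k i"] insert by (simp add: carr PiE_iff)
      fix j assume j: "j \<in> I"
      then have "(unit_vec p e I i [^]\<^bsub>G\<^esub> k i) j = unit_vec p e I i j [^]\<^bsub>integer_mod_group (p ^ e j)\<^esub> k i"
        unfolding G_def using u insert by (intro int_pow_product_group) (auto simp: G_def)
      also have "\<dots> = (k i * unit_vec p e I i j) mod int p ^ e j"
        by (simp add: int_pow_integer_mod_group)
      also have "\<dots> = (\<lambda>j\<in>I. if j = i then k i mod int p ^ e i else 0) j"
        using j by (simp add: unit_vec_def mod_mult_right_eq)
      finally show "(unit_vec p e I i [^]\<^bsub>G\<^esub> k i) j = (\<lambda>j\<in>I. if j = i then k i mod int p ^ e i else 0) j" .
    qed simp
    have "comb (insert i J) (unit_vec p e I) k =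
      unit_vec p e I i [^]\<^bsub>G\<^esub> k i \<otimes>\<^bsub>G\<^esub> comb J (unit_vec p e I) k"
      using u insert by (intro comb_insert) auto
    also have "\<dots> = (\<lambda>j\<in>I. if j \<in> insert i J then k j mod int p ^ e j else 0)"
      using insert unfolding pow by (auto simp: G_def intro!: restrict_ext)
    finally show ?case .
  qed
  have one: "\<one>\<^bsub>G\<^esub> = (\<lambda>i\<in>I. 0)" by (simp add: G_def)
  show ?thesis
    unfolding basis_def indep_def
  proof (intro conjI allI ballI u)
    fix k
    show "comb I (unit_vec p e I) k = \<one>\<^bsub>G\<^esub> \<longleftrightarrow> (\<forall>i\<in>I. int p ^ e i dvd k i)"
      unfolding comb[OF order_refl] one
      by (auto simp: fun_eq_iff restrict_def dvd_eq_mod_eq_0)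
  next
    fix x assume x: "x \<in> carrier G"
    have "x = comb I (unit_vec p e I) x"
      unfolding comb[OF order_refl] using x by (auto simp: carr PiE_iff extensional_def fun_eq_iff)
    then show "\<exists>k. x = comb I (unit_vec p e I) k" by (rule exI[of _ x])
  qed
qed

section \<open>Isomorphism classes and primary parts\<close>

text \<open>A type is witnessed by a basis, which transfers along isomorphisms. The index type is
  fixed, as it cannot be quantified here; pairs are the indices that \<open>partition_class\<close>
  uses.\<close>

definition of_type :: "nat \<Rightarrow> nat multiset \<Rightarrow> ('a, 'b) monoid_scheme \<Rightarrow> bool" where
  "of_type p l G \<longleftrightarrow> comm_group G \<and> finite (carrier G) \<and>
     (\<exists>(I :: (nat \<times> nat) set) e b. finite I \<and> (\<forall>i\<in>I. 0 < e i) \<and> image_mset e (mset_set I) = l \<and>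
        comm_group.basis G p e I b)"

lemma of_type_iso:
  assumes "of_type p l G" "G \<cong> H" "comm_group H"
  shows "of_type p l H"
proof -
  obtain h where "h \<in> iso G H" using assms(2) by (auto simp: is_iso_def)
  then show ?thesis
    using assms basis_iso iso_finite[OF assms(2)] unfolding of_type_def by metis
qed

lemma of_type_AutoGroup:
  assumes "prime p" "of_type p l G"
  shows "real (order (AutoGroup G)) = aut_size p l"
  using assms comm_group.order_AutoGroup unfolding of_type_def by metis

lemma of_type_card_torsion:
  assumes "prime p" "of_type p l G"
  shows "card (comm_group.torsion G (int p ^ c)) = p ^ (\<Sum>x\<in>#l. min x c)"
proof -
  obtain I :: "(nat \<times> nat) set" and e b where *: "comm_group G" "finite I" "image_mset e (mset_set I) = l"
    "comm_group.basis G p e I b"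
    using assms(2) unfolding of_type_def by blast
  have "(\<Sum>x\<in>#l. min x c) = (\<Sum>i\<in>I. min (e i) c)"
    by (simp add: *(3)[symmetric] sum_unfold_sum_mset multiset.map_comp o_def)
  then show ?thesis using comm_group.card_torsion[OF *(1) assms(1) *(2,4)] by simp
qed

text \<open>The sum \<open>c\<close> of the exponents bounds each of them, so \<open>p ^ c\<close>
  kills the group, which thus equals its own torsion of that exponent.\<close>

lemma of_type_order:
  assumes "prime p" "of_type p l G"
  shows "\<exists>c. order G = p ^ c"
proof -
  obtain I :: "(nat \<times> nat) set" and e b where *: "comm_group G" "finite I"
    "comm_group.basis G p e I b"
    using assms(2) unfolding of_type_def by blast
  interpret G: comm_group G by fact
  define c where "c = (\<Sum>i\<in>I. e i)"
  have "carrier G \<subseteq> G.torsion (int p ^ c)"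
  proof
    fix x assume x: "x \<in> carrier G"
    then obtain k where k: "x = G.comb I b k" using *(3) by (auto simp: G.basis_def)
    have bc: "b \<in> I \<rightarrow> carrier G" and ind: "G.indep p e I b" using *(3) by (auto simp: G.basis_def G.indep_def)
    have "e i \<le> c" if "i \<in> I" for i unfolding c_def using that *(2) by (intro member_le_sum) auto
    then have "G.comb I b (\<lambda>i. int p ^ c * k i) = \<one>\<^bsub>G\<^esub>"
      using ind by (auto simp: G.indep_def intro: dvd_mult2 le_imp_power_dvd)
    then show "x \<in> G.torsion (int p ^ c)"
      using x G.comb_scale[OF bc *(2)] by (simp add: G.torsion_def k)
  qed
  then have "carrier G = G.torsion (int p ^ c)" by (auto simp: G.torsion_def)
  then show ?thesis using of_type_card_torsion[OF assms, of c] by (metis order_def)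
qed

text \<open>First differences in \<open>c\<close> are the column lengths, second differences the
  multiplicities of positive parts; 0 does not occur in a partition. Through the torsion counts this
  makes the type of a group unique.\<close>

lemma sum_min_determines_partition:
  fixes l l' :: "nat multiset"
  assumes "\<And>c. (\<Sum>x\<in>#l. min x c) = (\<Sum>x\<in>#l'. min x c)" "l \<in> partitions" "l' \<in> partitions"
  shows "l = l'"
proof (rule multiset_eqI)
  have S: "(\<Sum>x\<in>#m. min x (Suc c)) = (\<Sum>x\<in>#m. min x c) + size (filter_mset (\<lambda>x. c < x) m)" for m :: "nat multiset" and c
    by (induction m) auto
  have N: "size (filter_mset (\<lambda>x. c < x) m) = size (filter_mset (\<lambda>x. Suc c < x) m) + count m (Suc c)" for c and m :: "nat multiset"
    by (induction m) auto
  have eq: "size (filter_mset (\<lambda>x. c < x) l) = size (filter_mset (\<lambda>x. c < x) l')" for c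
    using S[where m = l and c = c] S[where m = l' and c = c] assms(1)[of c] assms(1)[of "Suc c"] by linarith
  fix d
  show "count l d = count l' d"
  proof (cases d)
    case 0
    then show ?thesis using assms(2,3) by (simp add: partitions_def not_in_iff)
  next
    case (Suc c)
    then show ?thesis unfolding Suc using N[where m = l and c = c] N[where m = l' and c = c] eq[of c] eq[of "Suc c"] by linarith
  qed
qed

lemma of_type_unique:
  assumes p: "prime p" and "of_type p l G" "of_type p l' G" "l \<in> partitions" "l' \<in> partitions"
  shows "l = l'"
proof (rule sum_min_determines_partition)
  fix c
  have "p ^ (\<Sum>x\<in>#l. min x c) = p ^ (\<Sum>x\<in>#l'. min x c)"
    using of_type_card_torsion[OF p] assms by metis
  then show "(\<Sum>x\<in>#l. min x c) = (\<Sum>x\<in>#l'. min x c)"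
    using prime_gt_1_nat[OF p] by (simp add: power_inject_exp)
qed fact+

definition std_group :: "nat \<Rightarrow> nat multiset \<Rightarrow> (nat \<times> nat \<Rightarrow> int) monoid" where
  "std_group p l = product_group (SIGMA e:set_mset l. {..<count l e}) (\<lambda>(e, j). integer_mod_group (p ^ e))"

lemma of_type_std_group:
  assumes "p > 0" "l \<in> partitions"
  shows "of_type p l (std_group p l)"
proof -
  define I where "I = (SIGMA e:set_mset l. {..<count l e})"
  have G: "std_group p l = product_group I (\<lambda>i. integer_mod_group (p ^ fst i))"
    unfolding std_group_def I_def by (rule arg_cong2[where f = product_group]) auto
  have fin: "finite I" by (simp add: I_def)
  have "image_mset fst (mset_set I) = l"
  proof (rule multiset_eqI)
    fix d
    have "{i \<in> I. d = fst i} = Pair d ` {..<count l d}"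
      by (auto simp: I_def simp flip: count_greater_zero_iff)
    then have "card {i \<in> I. d = fst i} = count l d" by (simp add: card_image inj_on_def)
    then show "count (image_mset fst (mset_set I)) d = count l d"
      using fin by (simp add: count_image_mset' )
  qed
  moreover have "\<forall>i\<in>I. 0 < fst i"
    using assms(2) by (auto simp: I_def partitions_def intro!: gr0I)
  moreover have "comm_group (std_group p l)"
    unfolding G by (rule comm_group_product_group) simp
  moreover have "finite (carrier (std_group p l))"
    unfolding G using assms fin by (auto simp: carrier_integer_mod_group intro!: finite_PiE)
  ultimately show ?thesis
    unfolding of_type_def using basis_product_group[OF assms(1) fin, of fst] fin G by metis
qed

section \<open>Isomorphism classes and their representatives\<close>

lemma iso_class_cong:
  assumes "group G" "G \<cong> H"
  shows "iso_class G = iso_class H"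
  using group.iso_sym[OF assms] assms(2) iso_trans[of H G] iso_trans[of G H]
  unfolding iso_class_def by auto

text \<open>The groups constructed here live on function types; transport along an injection into
  the naturals gives them a member in the fixed universe of classes.\<close>

lemma fin_ab_copy:
  assumes "comm_group G" "finite (carrier G)"
  obtains H where "H \<in> fin_ab_groups" "G \<cong> H"
proof -
  interpret comm_group G by fact
  obtain f :: "_ \<Rightarrow> nat" where f: "inj_on f (carrier G)"
    using finite_imp_inj_to_nat_seg[OF assms(2)] by metis
  then have iso: "G \<cong> image_group f G" by (meson inj_imp_image_group_iso is_isoI)
  moreover have "comm_group (image_group f G)"
    using iso_imp_comm_group[OF iso] group.is_monoid[OF inj_imp_image_group_is_group[OF f]] by simp
  ultimately show thesis
    using that[of "image_group f G"] assms(2) by (simp add: fin_ab_groups_def image_group_carrier)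
qed

lemma rep_iso_class:
  assumes "comm_group G" "finite (carrier G)"
  shows "rep (iso_class G) \<in> fin_ab_groups" "G \<cong> rep (iso_class G)"
proof -
  have "rep (iso_class G) \<in> iso_class G"
    unfolding rep_def using fin_ab_copy[OF assms]
    by (intro someI_ex[of "\<lambda>H. H \<in> iso_class G"]) (auto simp: iso_class_def)
  then show "rep (iso_class G) \<in> fin_ab_groups" "G \<cong> rep (iso_class G)"
    by (auto simp: iso_class_def)
qed

lemma iso_class_mem:
  assumes "comm_group G" "finite (carrier G)"
  shows "iso_class G \<in> fin_ab_classes"
proof -
  obtain H where "H \<in> fin_ab_groups" "G \<cong> H" using fin_ab_copy[OF assms] .
  then show ?thesis
    using iso_class_cong[of G H] assms(1) comm_group.axioms(2) by (auto simp: fin_ab_classes_def)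
qed

lemma partition_class_std_group: "partition_class p l = iso_class (std_group p l)"
  by (simp add: partition_class_def std_group_def)

lemma of_type_rep_partition_class:
  assumes "prime p" "l \<in> partitions"
  shows "of_type p l (rep (partition_class p l))"
proof -
  have t: "of_type p l (std_group p l)"
    using assms by (intro of_type_std_group prime_gt_0_nat)
  have "rep (partition_class p l) \<in> fin_ab_groups" "std_group p l \<cong> rep (partition_class p l)"
    unfolding partition_class_std_group using t rep_iso_class by (auto simp: of_type_def)
  then show ?thesis by (intro of_type_iso[OF t]) (auto simp: fin_ab_groups_def)
qed

lemma partition_class_mem:
  assumes "prime p" "l \<in> partitions"
  shows "partition_class p l \<in> p_classes p"
proof -
  have t: "of_type p l (std_group p l)"
    using assms by (intro of_type_std_group prime_gt_0_nat)
  then have G: "comm_group (std_group p l)" "finite (carrier (std_group p l))" by (auto simp: of_type_def)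
  obtain H where H: "H \<in> fin_ab_groups" "std_group p l \<cong> H" using fin_ab_copy[OF G] .
  then have "iso_class (std_group p l) = iso_class H"
    using G comm_group.axioms(2) iso_class_cong by blast
  moreover have "\<exists>k. order H = p ^ k"
    using of_type_order[OF assms(1) t] iso_same_card[OF H(2)] by (simp add: order_def)
  ultimately show ?thesis
    unfolding partition_class_std_group p_classes_def using H by blast
qed

lemma inj_on_partition_class:
  assumes "prime p"
  shows "inj_on (partition_class p) partitions"
proof (rule inj_onI)
  fix l l' assume "l \<in> partitions" "l' \<in> partitions" "partition_class p l = partition_class p l'"
  then show "l = l'"
    using of_type_rep_partition_class[OF assms, of l] of_type_rep_partition_class[OF assms, of l']
    by (intro of_type_unique[OF assms]) auto
qed

lemma class_partition_inverse:
  assumes "prime p" "l \<in> partitions"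
  shows "class_partition p (partition_class p l) = l"
  unfolding class_partition_def using assms inj_on_partition_class by (intro inv_into_f_f)

section \<open>Primary parts\<close>

lemma group_primary_part:
  fixes G (structure)
  assumes "comm_group G"
  shows "group (primary_part p G)"
proof -
  interpret comm_group G by fact
  have "subgroup {x \<in> carrier G. \<exists>k::nat. x [^] (p ^ k) = \<one>} G"
  proof
    fix x y assume "x \<in> {x \<in> carrier G. \<exists>k::nat. x [^] (p ^ k) = \<one>}" "y \<in> {x \<in> carrier G. \<exists>k::nat. x [^] (p ^ k) = \<one>}"
    then obtain k m where *: "x \<in> carrier G" "y \<in> carrier G" "x [^] (p ^ k) = \<one>" "y [^] (p ^ m) = \<one>" by blast
    have "(x \<otimes> y) [^] (p ^ (k + m)) = (x [^] (p ^ k)) [^] (p ^ m) \<otimes> (y [^] (p ^ m)) [^] (p ^ k)"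
      using *(1,2) by (simp add: nat_pow_distrib nat_pow_pow power_add mult.commute)
    also have "\<dots> = \<one>" using * by (simp del: nat_pow_pow)
    finally show "x \<otimes> y \<in> {x \<in> carrier G. \<exists>k::nat. x [^] (p ^ k) = \<one>}" using * by auto
  qed (auto simp: nat_pow_inv intro: exI[of _ 0])
  then show ?thesis
    unfolding primary_part_def by (rule subgroup.subgroup_is_group) (rule is_group)
qed

lemma primary_part_iso:
  assumes "comm_group G" "comm_group H" "G \<cong> H"
  shows "primary_part p G \<cong> primary_part p H"
proof -
  interpret G: comm_group G by fact
  interpret H: comm_group H by fact
  obtain h where h: "h \<in> hom G H" "bij_betw h (carrier G) (carrier H)"
    using assms(3) by (auto simp: is_iso_def iso_def)
  have pow: "h x [^]\<^bsub>H\<^esub> n = \<one>\<^bsub>H\<^esub> \<longleftrightarrow> x [^]\<^bsub>G\<^esub> n = \<one>\<^bsub>G\<^esub>" if "x \<in> carrier G" for x and n :: nat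
    using hom_nat_pow[OF h(1) that G.is_group H.is_group, of n] hom_one[OF h(1) G.is_group H.is_group]
      h(2) that by (metis G.nat_pow_closed G.one_closed bij_betw_inv_into_left)
  have "h \<in> hom (primary_part p G) (primary_part p H)"
    using h(1) pow by (auto simp: hom_def primary_part_def)
  moreover have "bij_betw h (carrier (primary_part p G)) (carrier (primary_part p H))"
    unfolding bij_betw_def
  proof
    show "inj_on h (carrier (primary_part p G))"
      using h(2) by (auto simp: primary_part_def bij_betw_def inj_on_def)
    show "h ` carrier (primary_part p G) = carrier (primary_part p H)"
    proof safe
      fix y assume y: "y \<in> carrier (primary_part p H)"
      then obtain x where "x \<in> carrier G" "y = h x"
        using h(2) by (auto simp: primary_part_def bij_betw_def)
      then show "y \<in> h ` carrier (primary_part p G)"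
        using y pow by (auto simp: primary_part_def)
    qed (use h(1) pow in \<open>auto simp: primary_part_def hom_def\<close>)
  qed
  ultimately show ?thesis by (auto simp: is_iso_def iso_def)
qed

lemma primary_class_iso_class:
  assumes "comm_group G" "finite (carrier G)"
  shows "primary_class p (iso_class G) = iso_class (primary_part p G)"
  unfolding primary_class_def
  using assms rep_iso_class[OF assms] group_primary_part primary_part_iso
  by (intro iso_class_cong[symmetric]) (auto simp: fin_ab_groups_def)

text \<open>The coordinate at \<open>q \<noteq> p\<close> of an element killed by a power of
  \<open>p\<close> has order dividing both a power of \<open>p\<close> and a power of
  \<open>q\<close>, hence is trivial. Conversely, a vector supported at \<open>p\<close> is killed
  by the order of that factor.\<close>

lemma primary_part_product_std_group:
  fixes Q :: "nat set" and L :: "nat \<Rightarrow> nat multiset"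
  assumes Q: "finite Q" "\<And>q. q \<in> Q \<Longrightarrow> prime q" and p: "prime p"
    and L: "\<And>q. L q \<in> partitions" "\<And>q. q \<notin> Q \<Longrightarrow> L q = {#}"
  shows "primary_part p (product_group Q (\<lambda>q. std_group q (L q))) \<cong> std_group p (L p)"
proof -
  define G where "G = product_group Q (\<lambda>q. std_group q (L q))"
  have std: "comm_group (std_group q (L q))" "finite (carrier (std_group q (L q)))" if "prime q" for q
    using of_type_std_group[OF prime_gt_0_nat[OF that] L(1), of q] by (auto simp: of_type_def)
  have ord: "\<exists>c. order (std_group q (L q)) = q ^ c" if "prime q" for q
    using of_type_order[OF that of_type_std_group[OF prime_gt_0_nat[OF that] L(1)]] .
  interpret G: comm_group G unfolding G_def using std Q by (intro comm_group_product_group) auto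
  interpret S: comm_group "std_group p (L p)" using std p by blast
  have comp: "(x [^]\<^bsub>G\<^esub> n) q = x q [^]\<^bsub>std_group q (L q)\<^esub> n"
    if "x \<in> carrier G" "q \<in> Q" for x q and n :: nat
  proof -
    have "group (std_group q (L q))" if "q \<in> Q" for q
      using std(1)[OF Q(2)[OF that]] by (rule comm_group.axioms(2))
    then have "(x [^]\<^bsub>G\<^esub> int n) q = x q [^]\<^bsub>std_group q (L q)\<^esub> int n"
      unfolding G_def using that by (intro int_pow_product_group) (auto simp: G_def)
    then show ?thesis by (simp add: int_pow_int)
  qed
  \<comment> \<open>For \<open>p\<close> outside \<open>Q\<close> the default is right, since
    \<open>L p = {#}\<close> makes the target an empty product, that is a trivial group.\<close>
  define \<phi> where "\<phi> x = (if p \<in> Q then x p else \<one>\<^bsub>std_group p (L p)\<^esub>)" for x :: "nat \<Rightarrow> nat \<times> nat \<Rightarrow> int"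
  define \<psi> where "\<psi> y = (\<lambda>q\<in>Q. if q = p then y else \<one>\<^bsub>std_group q (L q)\<^esub>)" for y
  have carr: "x q \<in> carrier (std_group q (L q))" if "x \<in> carrier G" "q \<in> Q" for x q
    using that by (auto simp: G_def)
  have "\<phi> \<in> hom (primary_part p G) (std_group p (L p))"
    by (auto simp: hom_def primary_part_def \<phi>_def G_def)
  moreover have "bij_betw \<phi> (carrier (primary_part p G)) (carrier (std_group p (L p)))"
  proof (rule bij_betw_byWitness[where f' = \<psi>])
    show "\<phi> ` carrier (primary_part p G) \<subseteq> carrier (std_group p (L p))"
      by (auto simp: primary_part_def \<phi>_def G_def)
    show "\<psi> ` carrier (std_group p (L p)) \<subseteq> carrier (primary_part p G)"
    proof safe
      fix y assume y: "y \<in> carrier (std_group p (L p))"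
      have mem: "\<psi> y \<in> carrier G"
        using y std Q by (auto simp: \<psi>_def G_def comm_group.axioms(2) group.is_monoid)
      obtain c where c: "order (std_group p (L p)) = p ^ c" using ord p by blast
      have "(\<psi> y [^]\<^bsub>G\<^esub> (p ^ c)) q = \<one>\<^bsub>G\<^esub> q" if "q \<in> Q" for q
        using that y S.pow_order_eq_1[OF y] std[OF Q(2)[OF that]] unfolding comp[OF mem that] c
        by (auto simp: \<psi>_def G_def group.is_monoid comm_group.axioms(2) monoid.nat_pow_one)
      moreover have "\<psi> y [^]\<^bsub>G\<^esub> (p ^ c) \<in> carrier G" "\<one>\<^bsub>G\<^esub> \<in> carrier G" using mem by auto
      ultimately have "\<psi> y [^]\<^bsub>G\<^esub> (p ^ c) = \<one>\<^bsub>G\<^esub>"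
        by (intro PiE_ext[where k = Q and s = "\<lambda>q. carrier (std_group q (L q))"]) (auto simp: G_def)
      with mem show "\<psi> y \<in> carrier (primary_part p G)" by (auto simp: primary_part_def)
    qed
    show "\<forall>y\<in>carrier (std_group p (L p)). \<phi> (\<psi> y) = y"
      using L(2)[of p] by (auto simp: \<phi>_def \<psi>_def std_group_def)
    show "\<forall>x\<in>carrier (primary_part p G). \<psi> (\<phi> x) = x"
    proof
      fix x assume "x \<in> carrier (primary_part p G)"
      then obtain k where x: "x \<in> carrier G" and k: "x [^]\<^bsub>G\<^esub> (p ^ k) = \<one>\<^bsub>G\<^esub>"
        by (auto simp: primary_part_def)
      have "x q = \<one>\<^bsub>std_group q (L q)\<^esub>" if q: "q \<in> Q" "q \<noteq> p" for q
      proof -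
        interpret Sq: comm_group "std_group q (L q)" using std Q(2) q by blast
        have xq: "x q \<in> carrier (std_group q (L q))" using carr x q by blast
        have "x q [^]\<^bsub>std_group q (L q)\<^esub> (p ^ k) = \<one>\<^bsub>std_group q (L q)\<^esub>"
          using comp[OF x q(1), of "p ^ k"] k q by (simp add: G_def)
        moreover obtain c where "order (std_group q (L q)) = q ^ c" using ord Q(2) q by blast
        ultimately have "Sq.ord (x q) dvd p ^ k" "Sq.ord (x q) dvd q ^ c"
          using Sq.pow_eq_id[OF xq] Sq.ord_dvd_group_order[OF xq] by auto
        moreover have "coprime (p ^ k) (q ^ c)"
          using p Q(2)[OF q(1)] q(2) by (simp add: primes_coprime)
        ultimately have "Sq.ord (x q) = 1" by (metis coprime_common_divisor nat_dvd_1_iff_1)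
        then show ?thesis using Sq.pow_ord_eq_1[OF xq] xq by simp
      qed
      then show "\<psi> (\<phi> x) = x"
        using x by (auto simp: \<psi>_def \<phi>_def G_def PiE_iff extensional_def fun_eq_iff)
    qed
  qed
  ultimately show ?thesis unfolding G_def[symmetric] by (auto simp: is_iso_def iso_def)
qed

lemma fin_ab_class_with_primary_types:
  fixes Q :: "nat set" and L :: "nat \<Rightarrow> nat multiset"
  assumes Q: "finite Q" "\<And>q. q \<in> Q \<Longrightarrow> prime q"
    and L: "\<And>q. L q \<in> partitions" "\<And>q. q \<notin> Q \<Longrightarrow> L q = {#}"
  obtains X where "X \<in> fin_ab_classes" "\<And>p. prime p \<Longrightarrow> class_partition p (primary_class p X) = L p"
proof
  define G where "G = product_group Q (\<lambda>q. std_group q (L q))"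
  have std: "comm_group (std_group q (L q))" "finite (carrier (std_group q (L q)))" if "prime q" for q
    using of_type_std_group[OF prime_gt_0_nat[OF that] L(1), of q] by (auto simp: of_type_def)
  have G: "comm_group G" "finite (carrier G)"
    unfolding G_def using std Q by (auto intro!: comm_group_product_group finite_PiE)
  show "iso_class G \<in> fin_ab_classes" by (rule iso_class_mem[OF G])
  fix p :: nat assume p: "prime p"
  have "primary_class p (iso_class G) = iso_class (primary_part p G)"
    by (rule primary_class_iso_class[OF G])
  also have "\<dots> = iso_class (std_group p (L p))"
    unfolding G_def using primary_part_product_std_group[OF Q p L] G(1)
    by (intro iso_class_cong group_primary_part) (simp_all add: G_def)
  also have "\<dots> = partition_class p (L p)" by (simp add: partition_class_std_group)
  finally show "class_partition p (primary_class p (iso_class G)) = L p"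
    using class_partition_inverse[OF p L(1)] by simp
qed

section \<open>The local measures\<close>

definition cl_const :: "nat \<Rightarrow> real" where
  "cl_const p = (\<Prod>i. 1 - (1 / real p) ^ Suc i)"

lemma one_over_prime:
  assumes "prime p"
  shows "0 < 1 / real p" "1 / real p < 1" "1 / real p \<le> 1 / 2"
  using prime_ge_2_nat[OF assms] by (auto simp: field_simps)

lemma cl_const_pos: "prime p \<Longrightarrow> cl_const p > 0"
  unfolding cl_const_def using one_over_prime by (intro qpoch_tendsto)

definition partition_pmf :: "nat \<Rightarrow> nat multiset pmf" where
  "partition_pmf p = embed_pmf (\<lambda>l. cl_const p * part_weight (1 / real p) l * indicator partitions l)"

lemma pmf_partition_pmf:
  assumes p: "prime p"
  shows "pmf (partition_pmf p) l = cl_const p * part_weight (1 / real p) l * indicator partitions l"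
  unfolding partition_pmf_def
proof (rule pmf_embed_pmf)
  define t where "t = 1 / real p"
  have t: "0 < t" "t < 1" using one_over_prime[OF p] by (auto simp: t_def)
  note w = part_weight_pos[OF t, THEN less_imp_le]
  show "0 \<le> cl_const p * part_weight (1 / real p) x * indicator partitions x" for x
    using cl_const_pos[OF p] w by (simp add: t_def less_imp_le)
  have "(\<integral>\<^sup>+l. ennreal (cl_const p * part_weight t l * indicator partitions l) \<partial>count_space UNIV) =
    (\<integral>\<^sup>+l. ennreal (cl_const p) * (ennreal (part_weight t l) * indicator partitions l) \<partial>count_space UNIV)"
    using cl_const_pos[OF p] w
    by (intro nn_integral_cong) (auto simp: ennreal_mult less_imp_le split: split_indicator)
  also have "\<dots> = ennreal (cl_const p) * ennreal (1 / cl_const p)"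
    unfolding nn_integral_cmult[OF borel_measurable_count_space] nn_integral_part_weight[OF t]
    by (simp add: cl_const_def t_def)
  also have "\<dots> = 1"
    using cl_const_pos[OF p] by (simp flip: ennreal_mult)
  finally show "(\<integral>\<^sup>+l. ennreal (cl_const p * part_weight (1 / real p) l * indicator partitions l) \<partial>count_space UNIV) = 1"
    by (simp add: t_def)
qed

text \<open>\<open>partition_class p\<close> is injective, and the order of the automorphism group
  of a representative is the reciprocal of \<open>part_weight\<close>; so the point weights match
  term by term.\<close>

lemma measure_cohen_lenstra:
  assumes p: "prime p"
  shows "measure (cohen_lenstra p) (partition_class p ` {l \<in> partitions. E l}) = measure_pmf.prob (partition_pmf p) {l. E l}"
proof -
  define S where "S = {l \<in> partitions. E l}"
  define f where "f X = ennreal (1 / real (order (AutoGroup (rep X))) * (\<Prod>i. 1 - 1 / real p ^ Suc i))" for X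
  have sub: "partition_class p ` S \<subseteq> p_classes p" using partition_class_mem[OF p] by (auto simp: S_def)
  have inj: "inj_on (partition_class p) S"
    using inj_on_partition_class[OF p] by (rule inj_on_subset) (auto simp: S_def)
  have f: "f (partition_class p l) = ennreal (pmf (partition_pmf p) l)" if "l \<in> S" for l
  proof -
    have "real (order (AutoGroup (rep (partition_class p l)))) = aut_size p l"
      using that by (intro of_type_AutoGroup[OF p] of_type_rep_partition_class[OF p]) (simp add: S_def)
    moreover have "1 / aut_size p l = part_weight (1 / real p) l"
      by (simp add: aut_size_def part_weight_def power_one_over)
    ultimately show ?thesis
      using that by (simp add: f_def pmf_partition_pmf[OF p] cl_const_def S_def power_one_over mult.commute del: power_Suc)
  qed
  have "emeasure (cohen_lenstra p) (partition_class p ` S) = (\<integral>\<^sup>+X. f X * indicator (partition_class p ` S) X \<partial>count_space (p_classes p))"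
    unfolding cohen_lenstra_def point_measure_def f_def[symmetric] using sub by (subst emeasure_density) auto
  also have "\<dots> = (\<integral>\<^sup>+X. f X \<partial>count_space (partition_class p ` S))"
    using sub by (subst (1 2) nn_integral_count_space_indicator) (auto intro!: nn_integral_cong simp: image_subset_iff split: split_indicator)
  also have "\<dots> = (\<integral>\<^sup>+l. f (partition_class p l) \<partial>count_space S)"
    using inj by (intro nn_integral_bij_count_space[symmetric]) (simp add: bij_betw_def)
  also have "\<dots> = (\<integral>\<^sup>+l. ennreal (pmf (partition_pmf p) l) \<partial>count_space S)"
    using f by (intro nn_integral_cong) simp
  also have "\<dots> = emeasure (measure_pmf (partition_pmf p)) S"
    by (rule nn_integral_pmf)
  finally have "measure (cohen_lenstra p) (partition_class p ` S) = measure_pmf.prob (partition_pmf p) S"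
    by (simp add: measure_def)
  also have "\<dots> = measure_pmf.prob (partition_pmf p) {l. E l}"
    by (intro measure_prob_cong_0) (auto simp: S_def pmf_partition_pmf[OF p])
  finally show ?thesis by (simp add: S_def)
qed

text \<open>The factors beyond the first are bounded by one minus the geometric sum of
  \<open>t ^ k\<close> for \<open>k\<close> from 2 to \<open>n + 1\<close>, and
  \<open>1 / (1 - t) \<le> 2\<close>. The correction \<open>2 * t ^ (n + 2)\<close> makes the bound
  inductive and vanishes in the limit.\<close>

lemma qpoch_ge:
  assumes t: "0 < t" "t \<le> 1 / 2"
  shows "qpoch t (Suc n) \<ge> (1 - t) * (1 - 2 * t\<^sup>2 + 2 * t ^ (n + 2))"
proof (induction n)
  case 0
  then show ?case by (simp add: qpoch_def power2_eq_square)
next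
  case (Suc n)
  define u where "u = t ^ (n + 2)"
  have u: "0 < u" "u \<le> t\<^sup>2" using t power_decreasing[of 2 "n + 2" t] by (auto simp: u_def)
  have t2: "t\<^sup>2 \<le> t * (1 / 2)" unfolding power2_eq_square using t by (intro mult_left_mono) auto
  \<comment> \<open>The slack of the induction step; the last factor is nonnegative because
    \<open>u \<le> t\<^sup>2\<close> and \<open>t \<le> 1 / 2\<close>.\<close>
  have "0 \<le> u * (1 + 2 * t\<^sup>2 - 2 * u - 2 * t)" using t u by (intro mult_nonneg_nonneg) auto
  also have "\<dots> = (1 - 2 * t\<^sup>2 + 2 * u) * (1 - u) - (1 - 2 * t\<^sup>2 + 2 * (t * u))"
    by (simp add: algebra_simps)
  finally have "(1 - t) * (1 - 2 * t\<^sup>2 + 2 * (t * u)) \<le> (1 - t) * ((1 - 2 * t\<^sup>2 + 2 * u) * (1 - u))"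
    using t by (intro mult_left_mono) auto
  also have "\<dots> \<le> qpoch t (Suc n) * (1 - u)"
    using Suc u t t2 unfolding u_def[symmetric] by (subst mult.assoc[symmetric], intro mult_right_mono) auto
  also have "\<dots> = qpoch t (Suc (Suc n))" by (simp add: qpoch_Suc[of t "Suc n"] u_def)
  finally show ?case by (simp add: u_def)
qed

lemma cl_const_ge:
  assumes p: "prime p"
  shows "cl_const p \<ge> (1 - 1 / real p) * (1 - 2 * (1 / real p)\<^sup>2)"
proof (rule LIMSEQ_le_const)
  define t where "t = 1 / real p"
  have t: "0 < t" "t < 1" "t \<le> 1 / 2" using one_over_prime[OF p] by (auto simp: t_def)
  show "(\<lambda>n. qpoch t (Suc n)) \<longlonglongrightarrow> cl_const p"
    unfolding cl_const_def t_def[symmetric] using qpoch_tendsto(1)[OF t(1,2)] by (rule LIMSEQ_Suc)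
  have "(1 - t) * (1 - 2 * t\<^sup>2) \<le> qpoch t (Suc n)" for n
  proof -
    have "(1 - t) * (1 - 2 * t\<^sup>2) \<le> (1 - t) * (1 - 2 * t\<^sup>2 + 2 * t ^ (n + 2))"
      using t by (intro mult_left_mono) auto
    also have "\<dots> \<le> qpoch t (Suc n)" by (rule qpoch_ge[OF t(1,3)])
    finally show ?thesis .
  qed
  then show "\<exists>N. \<forall>n\<ge>N. (1 - 1 / real p) * (1 - 2 * (1 / real p)\<^sup>2) \<le> qpoch t (Suc n)"
    unfolding t_def by blast
qed

text \<open>What matters is a positive bound uniform in \<open>p\<close>; \<open>1 / 4\<close> is
  the value of the bound of \<open>cl_const_ge\<close> at \<open>p = 2\<close>.\<close>

lemma prob_trivial_ge:
  assumes p: "prime p"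
  shows "measure_pmf.prob (partition_pmf p) {{#}} \<ge> 1 / 4"
proof -
  define t where "t = 1 / real p"
  have t: "0 < t" "t \<le> 1 / 2" using one_over_prime[OF p] by (auto simp: t_def)
  have "t\<^sup>2 \<le> (1 / 2)\<^sup>2" using t by (intro power_mono) auto
  then have "1 / 2 * (1 / 2) \<le> (1 - t) * (1 - 2 * t\<^sup>2)"
    using t by (intro mult_mono) (auto simp: power2_eq_square)
  also have "\<dots> \<le> cl_const p" using cl_const_ge[OF p] by (simp add: t_def)
  finally show ?thesis
    by (simp add: measure_pmf_single pmf_partition_pmf[OF p] part_weight_def partitions_def)
qed

text \<open>The two weights are \<open>1\<close> and \<open>t / (1 - t)\<close>, with sum
  \<open>1 / (1 - t)\<close>. This cancels the factor \<open>1 - t\<close> in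
  \<open>cl_const_ge\<close> and leaves an error of second order, which is summable.\<close>

lemma prob_trivial_or_cyclic_ge:
  assumes p: "prime p"
  shows "measure_pmf.prob (partition_pmf p) {{#}, {#1#}} \<ge> 1 - 2 * (1 / real p)\<^sup>2"
proof -
  define t where "t = 1 / real p"
  have t: "0 < t" "t < 1" using one_over_prime[OF p] by (auto simp: t_def)
  have "measure_pmf.prob (partition_pmf p) {{#}, {#1#}} = pmf (partition_pmf p) {#} + pmf (partition_pmf p) {#1#}"
    by (subst measure_measure_pmf_finite) auto
  also have "\<dots> = cl_const p * (1 + t / (1 - t))"
    by (simp add: pmf_partition_pmf[OF p] part_weight_def partitions_def t_def[symmetric] qpoch_def algebra_simps)
  also have "\<dots> = cl_const p / (1 - t)" using t by (simp add: field_simps)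
  also have "\<dots> \<ge> 1 - 2 * t\<^sup>2"
    using cl_const_ge[OF p] t by (simp add: field_simps t_def[symmetric])
  finally show ?thesis by (simp add: t_def)
qed

section \<open>The global measure\<close>

text \<open>A point mass at nonprime indices lets the product run over all natural numbers.\<close>

definition local_pmf :: "nat \<Rightarrow> nat multiset pmf" where
  "local_pmf n = (if prime n then partition_pmf n else return_pmf {#})"

definition cl_product :: "(nat \<Rightarrow> nat multiset) measure" where
  "cl_product = PiM UNIV (\<lambda>n. measure_pmf (local_pmf n))"

interpretation cl: product_prob_space "\<lambda>n. measure_pmf (local_pmf n)" UNIV
  rewrites "PiM UNIV (\<lambda>n. measure_pmf (local_pmf n)) \<equiv> cl_product"
  unfolding cl_product_def by unfold_locales

lemma space_cl_product [simp]: "space cl_product = UNIV"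
  by (simp add: cl_product_def space_PiM)

lemma measurable_component_cl_product [measurable]: "(\<lambda>\<omega>. \<omega> n) \<in> measurable cl_product (count_space UNIV)"
proof -
  have "(\<lambda>\<omega>. \<omega> n) \<in> measurable cl_product (measure_pmf (local_pmf n))"
    unfolding cl_product_def by (rule measurable_component_singleton) simp
  then show ?thesis by simp
qed

lemma pred_component_cl_product: "Measurable.pred cl_product (\<lambda>\<omega>. E (\<omega> n))"
  using measurable_compose[OF measurable_component_cl_product, of E "count_space UNIV"] by simp

lemma prob_cl_product_finite:
  assumes "finite J" "\<And>p. p \<in> J \<Longrightarrow> prime p"
  shows "measure cl_product {\<omega>. \<forall>p\<in>J. E (\<omega> p)} = (\<Prod>p\<in>J. measure_pmf.prob (partition_pmf p) {l. E l})"
proof -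
  have "{\<omega>. \<forall>p\<in>J. E (\<omega> p)} = prod_emb UNIV (\<lambda>n. measure_pmf (local_pmf n)) J (\<Pi>\<^sub>E p\<in>J. {l. E l})"
    by (auto simp: prod_emb_def space_PiM)
  then show ?thesis
    using cl.measure_PiM_emb[of J "\<lambda>_. {l. E l}"] assms by (simp add: local_pmf_def)
qed

text \<open>Continuity from above along the events that test the primes up to \<open>n\<close>, each
  evaluated by independence.\<close>

lemma prob_cl_product_tendsto:
  "(\<lambda>n. \<Prod>p | prime p \<and> p \<le> n. measure_pmf.prob (partition_pmf p) {l. E l})
     \<longlonglongrightarrow> measure cl_product {\<omega>. \<forall>p. prime p \<longrightarrow> E (\<omega> p)}"
proof -
  note pred_component_cl_product [of E, measurable]
  define A where "A n = {\<omega> :: nat \<Rightarrow> nat multiset. \<forall>p\<in>{p. prime p \<and> p \<le> n}. E (\<omega> p)}" for n :: nat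
  have "range A \<subseteq> sets cl_product"
  proof
    fix B assume "B \<in> range A"
    then obtain n where "B = A n" by blast
    also have "A n = {\<omega> \<in> space cl_product. \<forall>p\<in>{p. prime p \<and> p \<le> n}. E (\<omega> p)}" by (simp add: A_def)
    also have "\<dots> \<in> sets cl_product" by measurable
    finally show "B \<in> sets cl_product" .
  qed
  moreover have "decseq A" by (auto simp: decseq_def A_def)
  ultimately have "(\<lambda>n. measure cl_product (A n)) \<longlonglongrightarrow> measure cl_product (\<Inter>n. A n)"
    by (rule cl.finite_Lim_measure_decseq)
  moreover have "(\<Inter>n. A n) = {\<omega>. \<forall>p. prime p \<longrightarrow> E (\<omega> p)}" by (auto simp: A_def)
  moreover have "measure cl_product (A n) = (\<Prod>p | prime p \<and> p \<le> n. measure_pmf.prob (partition_pmf p) {l. E l})" for n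
    unfolding A_def by (rule prob_cl_product_finite) auto
  ultimately show ?thesis by simp
qed

lemma AE_partitions: "AE \<omega> in cl_product. \<forall>p. prime p \<longrightarrow> \<omega> p \<in> partitions"
  unfolding AE_all_countable
proof
  fix p
  have "AE l in measure_pmf (local_pmf p). prime p \<longrightarrow> l \<in> partitions"
    by (auto simp: AE_measure_pmf_iff local_pmf_def set_pmf_iff pmf_partition_pmf split: split_indicator_asm)
  then show "AE \<omega> in cl_product. prime p \<longrightarrow> \<omega> p \<in> partitions"
    by (rule cl.AE_component[OF UNIV_I])
qed

lemma AE_eventually_trivial_or_cyclic:
  "AE \<omega> in cl_product. \<forall>\<^sub>F p in sequentially. prime p \<longrightarrow> \<omega> p \<in> {{#}, {#1#}}"
proof -
  note pred_component_cl_product [of "\<lambda>l. l \<in> {{#}, {#1#}}", measurable]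
  define A where "A n = {\<omega> \<in> space cl_product. prime n \<and> \<omega> n \<notin> {{#}, {#1#}}}" for n
  have sets: "A n \<in> sets cl_product" for n unfolding A_def by measurable
  have le: "measure cl_product (A n) \<le> 2 * (1 / real n)\<^sup>2" for n
  proof (cases "prime n")
    case True
    have "A n = {\<omega>. \<forall>p\<in>{n}. \<omega> p \<notin> {{#}, {#1#}}}" using True by (auto simp: A_def)
    also have "measure cl_product \<dots> = measure_pmf.prob (partition_pmf n) {l. l \<notin> {{#}, {#1#}}}"
      using True by (subst prob_cl_product_finite) auto
    also have "{l. l \<notin> {{#}, {#1#}}} = space (measure_pmf (partition_pmf n)) - {{#}, {#1#}}" by auto
    also have "measure_pmf.prob (partition_pmf n) \<dots> = 1 - measure_pmf.prob (partition_pmf n) {{#}, {#1#}}"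
      by (rule measure_pmf.prob_compl) simp
    finally show ?thesis using prob_trivial_or_cyclic_ge[OF True] by simp
  qed (simp add: A_def)
  have "summable (\<lambda>n. 2 * (1 / real n)\<^sup>2)"
    using inverse_power_summable[of 2, where 'a = real] by (intro summable_mult) (simp add: divide_inverse power_inverse)
  then have "summable (\<lambda>n. measure cl_product (A n))"
    by (rule summable_comparison_test[rotated]) (use le in auto)
  then have "AE \<omega> in cl_product. \<forall>\<^sub>F n in sequentially. \<omega> \<in> space cl_product - A n"
    using sets by (intro borel_cantelli_AE1) (auto simp: cl.emeasure_eq_measure)
  then show ?thesis by eventually_elim (auto simp: A_def elim: eventually_mono)
qed

text \<open>By independence, \<open>k\<close> prescribed primes all carry nontrivial partitions with
  probability at most \<open>(3 / 4) ^ k\<close>. The empty partition must occur because every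
  finite group has trivial primary parts at almost all primes.\<close>

lemma AE_exists_trivial: "AE \<omega> in cl_product. \<exists>p. prime p \<and> \<omega> p = {#}"
proof -
  define B where "B = {\<omega> \<in> space cl_product. \<forall>p. prime p \<longrightarrow> \<omega> p \<noteq> {#}}"
  have B: "B \<in> sets cl_product" unfolding B_def by measurable
  have le: "measure cl_product B \<le> (3 / 4) ^ k" for k
  proof -
    obtain J where J: "finite J" "card J = k" "J \<subseteq> {p :: nat. prime p}"
      using infinite_arbitrarily_large[OF primes_infinite] by blast
    have "{\<omega>. \<forall>p\<in>J. \<omega> p \<noteq> {#}} = {\<omega> \<in> space cl_product. \<forall>p\<in>J. \<omega> p \<noteq> {#}}" by simp
    also have "\<dots> \<in> sets cl_product" using J countable_finite[OF J(1)] by measurable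
    finally have "measure cl_product B \<le> measure cl_product {\<omega>. \<forall>p\<in>J. \<omega> p \<noteq> {#}}"
      using J by (intro cl.finite_measure_mono) (auto simp: B_def)
    also have "\<dots> = (\<Prod>p\<in>J. measure_pmf.prob (partition_pmf p) {l. l \<noteq> {#}})"
      using J by (intro prob_cl_product_finite) auto
    also have "\<dots> \<le> (\<Prod>p\<in>J. 3 / 4)"
    proof (intro prod_mono conjI measure_nonneg)
      fix p assume "p \<in> J"
      then have "prime p" using J by auto
      have "{l. l \<noteq> {#}} = space (measure_pmf (partition_pmf p)) - {{#}}" by auto
      then have "measure_pmf.prob (partition_pmf p) {l. l \<noteq> {#}} = 1 - measure_pmf.prob (partition_pmf p) {{#}}"
        using measure_pmf.prob_compl[of "{{#}}" "partition_pmf p"] by simp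
      then show "measure_pmf.prob (partition_pmf p) {l. l \<noteq> {#}} \<le> 3 / 4"
        using prob_trivial_ge[OF \<open>prime p\<close>] by simp
    qed
    finally show ?thesis using J by simp
  qed
  have "measure cl_product B \<le> 0"
    by (rule LIMSEQ_le_const[OF LIMSEQ_realpow_zero[of "3 / 4"]]) (use le in auto)
  then have "B \<in> null_sets cl_product"
    using B by (auto simp: null_sets_def cl.emeasure_eq_measure measure_le_0_iff)
  then show ?thesis by (rule AE_I') (auto simp: B_def)
qed

text \<open>The eventual restriction to two values replaces plain finiteness of the range:
  Borel--Cantelli supplies it, and countable quantifiers over single coordinates make it
  measurable.\<close>

definition finite_type :: "(nat \<Rightarrow> nat multiset) \<Rightarrow> bool" where
  "finite_type \<omega> \<longleftrightarrow> (\<forall>p. prime p \<longrightarrow> \<omega> p \<in> partitions) \<and>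
     (\<exists>N. \<forall>p\<ge>N. prime p \<longrightarrow> \<omega> p \<in> {{#}, {#1#}}) \<and> (\<exists>p. prime p \<and> \<omega> p = {#})"

lemma AE_finite_type: "AE \<omega> in cl_product. finite_type \<omega>"
  using AE_partitions AE_eventually_trivial_or_cyclic AE_exists_trivial
  by eventually_elim (simp add: finite_type_def eventually_sequentially)

lemma sets_finite_type [measurable]: "Measurable.pred cl_product finite_type"
proof -
  note pred_component_cl_product [of "\<lambda>l. l \<in> {{#}, {#1#}}", measurable]
  note pred_component_cl_product [of "\<lambda>l. l \<in> partitions", measurable]
  show ?thesis unfolding finite_type_def by measurable
qed

section \<open>Sets of types realised by finite abelian groups\<close>

definition class_types :: "nat monoid set \<Rightarrow> nat multiset set" where
  "class_types X = (\<lambda>p. class_partition p (primary_class p X)) ` {p. prime p}"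

lemma uniform_set_iff: "X \<in> uniform_set E \<longleftrightarrow> X \<in> fin_ab_classes \<and> class_types X \<subseteq> {l. E l}"
  by (auto simp: uniform_set_def uniform_holds_def class_types_def)

text \<open>Each member of \<open>F\<close> is placed at a prime of its own; all other primes carry
  \<open>{#}\<close>, which is why \<open>F\<close> must contain it.\<close>

lemma ex_class_types:
  assumes F: "finite F" "F \<subseteq> partitions" "{#} \<in> F"
  shows "\<exists>X\<in>fin_ab_classes. class_types X = F"
proof -
  obtain Q :: "nat set" where Q: "finite Q" "card Q = card F" "Q \<subseteq> {p. prime p}"
    using infinite_arbitrarily_large[OF primes_infinite] by blast
  obtain f where f: "bij_betw f Q F" using finite_same_card_bij[OF Q(1) F(1) Q(2)] by blast
  define L where "L q = (if q \<in> Q then f q else {#})" for q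
  have LF: "L q \<in> F" for q using f F(3) by (auto simp: L_def bij_betw_def)
  obtain X where X: "X \<in> fin_ab_classes" "\<And>p. prime p \<Longrightarrow> class_partition p (primary_class p X) = L p"
  proof (rule fin_ab_class_with_primary_types[of Q L])
    show "\<And>q. L q \<in> partitions" using LF F(2) by blast
  qed (use Q in \<open>auto simp: L_def\<close>)
  have "class_types X = L ` {p. prime p}"
    unfolding class_types_def using X(2) by (intro image_cong) auto
  also have "\<dots> = F"
  proof
    show "F \<subseteq> L ` {p. prime p}"
    proof
      fix l assume "l \<in> F"
      then obtain q where "q \<in> Q" "l = f q" using f by (auto simp: bij_betw_def)
      then show "l \<in> L ` {p. prime p}" using Q(3) by (auto simp: L_def)
    qed
  qed (use LF in auto)
  finally show ?thesis using X(1) by blast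
qed

lemma finite_type_class:
  assumes "finite_type \<omega>"
  shows "\<exists>X\<in>fin_ab_classes. class_types X = \<omega> ` {p. prime p}"
proof (rule ex_class_types)
  obtain N where N: "\<And>p. p \<ge> N \<Longrightarrow> prime p \<Longrightarrow> \<omega> p \<in> {{#}, {#1#}}"
    using assms by (auto simp: finite_type_def)
  have "\<omega> ` {p. prime p} \<subseteq> \<omega> ` {..<N} \<union> {{#}, {#1#}}"
    using N by (auto simp: not_less[symmetric])
  then show "finite (\<omega> ` {p. prime p})" by (rule finite_subset) auto
  show "\<omega> ` {p. prime p} \<subseteq> partitions" using assms by (auto simp: finite_type_def)
  show "{#} \<in> \<omega> ` {p. prime p}" using assms unfolding finite_type_def by (metis imageI mem_Collect_eq)
qed

theorem theorem2p11:
  shows "\<exists>P :: nat monoid set measure.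
    prob_space P \<and>
    space P = fin_ab_classes \<and>
    sets P = sigma_sets fin_ab_classes (range uniform_set) \<and>
    (\<forall>E :: nat multiset \<Rightarrow> bool.
       uniform_set E \<in> sets P \<and>
       (\<lambda>n::nat. \<Prod>p | prime p \<and> p \<le> n.
          measure (cohen_lenstra p) (partition_class p ` {l \<in> partitions. E l}))
         \<longlonglongrightarrow> measure P (uniform_set E))"
proof -
  obtain X0 where X0: "X0 \<in> fin_ab_classes"
    using ex_class_types[of "{{#}}"] by (auto simp: partitions_def)
  \<comment> \<open>\<open>X0\<close> is an arbitrary class that makes \<open>g\<close> total; it is
    used only on a null set.\<close>
  define g where "g \<omega> = (if finite_type \<omega> then SOME X. X \<in> fin_ab_classes \<and> class_types X = \<omega> ` {p. prime p} else X0)" for \<omega>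
  have g: "g \<omega> \<in> fin_ab_classes \<and> class_types (g \<omega>) = \<omega> ` {p. prime p}" if "finite_type \<omega>" for \<omega>
    using someI_ex[OF finite_type_class[OF that, unfolded Bex_def]] that by (simp add: g_def)
  have g_mem: "g \<omega> \<in> fin_ab_classes" for \<omega>
    using g X0 by (cases "finite_type \<omega>") (auto simp: g_def)
  have g_uniform: "g \<omega> \<in> uniform_set E \<longleftrightarrow> (if finite_type \<omega> then \<forall>p. prime p \<longrightarrow> E (\<omega> p) else X0 \<in> uniform_set E)" for \<omega> E
    using g[of \<omega>] by (auto simp: uniform_set_iff g_def)
  have sub: "range uniform_set \<subseteq> Pow fin_ab_classes" by (auto simp: uniform_set_def)
  define M where "M = sigma fin_ab_classes (range uniform_set)"
  have M: "space M = fin_ab_classes" "sets M = sigma_sets fin_ab_classes (range uniform_set)"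
    using sub by (simp_all add: M_def)
  have U: "uniform_set E \<in> sets M" for E by (auto simp: M)
  have meas: "g \<in> measurable cl_product M"
    unfolding M_def
  proof (rule measurable_measure_of[OF sub])
    \<comment> \<open>Only generators need checking. Although \<open>g\<close> is built by choice,
      membership of \<open>g \<omega>\<close> in \<open>uniform_set E\<close> depends on the values
      of \<open>\<omega>\<close> alone, so its preimage is a countable condition on
      coordinates.\<close>
    fix A assume "A \<in> range uniform_set"
    then obtain E where A: "A = uniform_set E" by blast
    have "g -` A \<inter> space cl_product =
      {\<omega> \<in> space cl_product. if finite_type \<omega> then \<forall>p. prime p \<longrightarrow> E (\<omega> p) else X0 \<in> uniform_set E}"
      using g_uniform by (auto simp: A)
    also have "\<dots> \<in> sets cl_product"
      using pred_component_cl_product [of E, measurable] by measurable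
    finally show "g -` A \<inter> space cl_product \<in> sets cl_product" .
  qed (use g_mem in auto)
  define P where "P = distr cl_product M g"
  have "measure P (uniform_set E) = measure cl_product {\<omega>. \<forall>p. prime p \<longrightarrow> E (\<omega> p)}" for E
  proof -
    have "measure P (uniform_set E) = measure cl_product (g -` uniform_set E \<inter> space cl_product)"
      unfolding P_def by (rule measure_distr[OF meas U])
    also have "\<dots> = measure cl_product {\<omega> \<in> space cl_product. \<forall>p. prime p \<longrightarrow> E (\<omega> p)}"
    proof (rule cl.finite_measure_eq_AE)
      \<comment> \<open>On sequences of finite type the two events coincide by
        \<open>g_uniform\<close>.\<close>
      show "AE \<omega> in cl_product. \<omega> \<in> g -` uniform_set E \<inter> space cl_product \<longleftrightarrow>
        \<omega> \<in> {\<omega> \<in> space cl_product. \<forall>p. prime p \<longrightarrow> E (\<omega> p)}"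
        using AE_finite_type by eventually_elim (simp add: g_uniform)
      show "g -` uniform_set E \<inter> space cl_product \<in> sets cl_product" by (rule measurable_sets[OF meas U])
      show "{\<omega> \<in> space cl_product. \<forall>p. prime p \<longrightarrow> E (\<omega> p)} \<in> sets cl_product"
        using pred_component_cl_product [of E, measurable] by measurable
    qed
    finally show ?thesis by simp
  qed
  moreover have "(\<lambda>n. \<Prod>p | prime p \<and> p \<le> n. measure (cohen_lenstra p) (partition_class p ` {l \<in> partitions. E l})) =
      (\<lambda>n. \<Prod>p | prime p \<and> p \<le> n. measure_pmf.prob (partition_pmf p) {l. E l})" for E
    by (intro ext prod.cong) (auto simp: measure_cohen_lenstra)
  moreover have "prob_space P" unfolding P_def by (rule cl.prob_space_distr[OF meas])
  moreover have "space P = fin_ab_classes" "sets P = sigma_sets fin_ab_classes (range uniform_set)"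
    by (simp_all add: P_def M)
  ultimately show ?thesis
    using prob_cl_product_tendsto U by (intro exI[of _ P]) (auto simp: P_def)
qed

end
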